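(* Let $F$ be a field of characteristic zero, $n\ge 3$, and let $V=\mathfrak{sl}_n(F)$ be the adjoint representation of $SL_n(F)$, on which $SL_n(F[t])$ acts via $SL_n(F[t])\xrightarrow{t=0}SL_n(F)$. Then $$H^1(SL_n(F[t]),V)\cong H^1(SL_n(F),V)\oplus \mathrm{Hom}_B(H_1(C),V).$$
   Context: Cohomology is group cohomology of abstract groups. $B\subset SL_n(F)$ is the subgroup of upper triangular matrices. $K$ is the subgroup of $SL_n(F[t])$ of matrices congruent to the identity modulo $t$, and $C$ is the upper triangular subgroup of $K$ (upper triangular matrices over $F[t]$ that are congruent to the identity modulo $t$; these are unipotent). $H_1(C)=C/[C,C]$ is integral first homology, $B$ acts on it by conjugation, and $\mathrm{Hom}_B$ denotes $B$-equivariant homomorphisms of abelian groups. *)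

theory Defs
  imports
    "HOL-Algebra.AbelCoset"
    "HOL-Algebra.Generated_Groups"
    "Jordan_Normal_Form.VS_Connect"
begin

definition isomorphic_modules ::
  "('f, 'c) ring_scheme \<Rightarrow> ('f, 'v, 'm) module_scheme \<Rightarrow> ('f, 'w, 'k) module_scheme \<Rightarrow> bool" where
  "isomorphic_modules R M N \<longleftrightarrow>
     (\<exists>\<Phi> \<in> LinearCombinations.module_hom R M N. bij_betw \<Phi> (carrier M) (carrier N))"

text \<open>The type of modules is an extension of the type of rings; its fields \<open>mult\<close> and \<open>one\<close>
  play no role for modules.\<close>

definition quotient_module :: "('f, 'v) module \<Rightarrow> 'v set \<Rightarrow> ('f, 'v set) module" where
  "quotient_module M N = \<lparr>carrier = a_rcosets\<^bsub>M\<^esub> N,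
     mult = undefined, one = undefined,
     zero = N, add = set_add M,
     smult = (\<lambda>a X. \<Union>x\<in>X. N +>\<^bsub>M\<^esub> (a \<odot>\<^bsub>M\<^esub> x))\<rparr>"

text \<open>Cohomology of a group \<open>G\<close> with coefficients in a module \<open>V\<close> on which \<open>G\<close> acts linearly by
  \<open>\<rho>\<close>, defined by inhomogeneous (bar) cochains. A \<open>q\<close>-cochain is a function of \<open>q\<close>-tuples,
  represented by lists, and is \<open>undefined\<close> outside of them.\<close>

definition tuples :: "('g, 'm) monoid_scheme \<Rightarrow> nat \<Rightarrow> 'g list set" where
  "tuples G q = {gs. length gs = q \<and> set gs \<subseteq> carrier G}"

definition cochains ::
  "('g, 'm) monoid_scheme \<Rightarrow> ('f, 'v) module \<Rightarrow> nat \<Rightarrow> ('f, 'g list \<Rightarrow> 'v) module" where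
  "cochains G V q = \<lparr>carrier = tuples G q \<rightarrow>\<^sub>E carrier V,
     mult = undefined, one = undefined,
     zero = (\<lambda>gs\<in>tuples G q. \<zero>\<^bsub>V\<^esub>),
     add = (\<lambda>f h. \<lambda>gs\<in>tuples G q. f gs \<oplus>\<^bsub>V\<^esub> h gs),
     smult = (\<lambda>a f. \<lambda>gs\<in>tuples G q. a \<odot>\<^bsub>V\<^esub> f gs)\<rparr>"

definition alternate :: "('f, 'v) module \<Rightarrow> nat \<Rightarrow> 'v \<Rightarrow> 'v" where
  "alternate V i x = (if even i then x else \<ominus>\<^bsub>V\<^esub> x)"

definition merge_at :: "('g, 'm) monoid_scheme \<Rightarrow> nat \<Rightarrow> 'g list \<Rightarrow> 'g list" where
  "merge_at G i gs = take i gs @ (gs ! i \<otimes>\<^bsub>G\<^esub> gs ! Suc i) # drop (i + 2) gs"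

text \<open>With tuples indexed from \<open>0\<close>, this is
  \[ (df)(g_0,\dots,g_q) = g_0 f(g_1,\dots,g_q)
     + \sum_{i<q} (-1)^{i+1} f(\dots,g_i g_{i+1},\dots) + (-1)^{q+1} f(g_0,\dots,g_{q-1}). \]\<close>

definition coboundary_map ::
  "('g, 'm) monoid_scheme \<Rightarrow> ('f, 'v) module \<Rightarrow> ('g \<Rightarrow> 'v \<Rightarrow> 'v) \<Rightarrow> nat
     \<Rightarrow> ('g list \<Rightarrow> 'v) \<Rightarrow> ('g list \<Rightarrow> 'v)" where
  "coboundary_map G V \<rho> q f = (\<lambda>gs\<in>tuples G (Suc q).
     \<rho> (hd gs) (f (tl gs))
     \<oplus>\<^bsub>V\<^esub> (\<Oplus>\<^bsub>V\<^esub>i\<in>{..<q}. alternate V (Suc i) (f (merge_at G i gs)))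
     \<oplus>\<^bsub>V\<^esub> alternate V (Suc q) (f (butlast gs)))"

definition cocycles ::
  "('g, 'm) monoid_scheme \<Rightarrow> ('f, 'v) module \<Rightarrow> ('g \<Rightarrow> 'v \<Rightarrow> 'v) \<Rightarrow> nat
     \<Rightarrow> ('g list \<Rightarrow> 'v) set" where
  "cocycles G V \<rho> q = {f \<in> carrier (cochains G V q).
     coboundary_map G V \<rho> q f = \<zero>\<^bsub>cochains G V (Suc q)\<^esub>}"

fun coboundaries ::
  "('g, 'm) monoid_scheme \<Rightarrow> ('f, 'v) module \<Rightarrow> ('g \<Rightarrow> 'v \<Rightarrow> 'v) \<Rightarrow> nat
     \<Rightarrow> ('g list \<Rightarrow> 'v) set" where
  "coboundaries G V \<rho> 0 = {\<zero>\<^bsub>cochains G V 0\<^esub>}"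
| "coboundaries G V \<rho> (Suc q) = coboundary_map G V \<rho> q ` carrier (cochains G V q)"

definition group_cohomology ::
  "nat \<Rightarrow> ('g, 'm) monoid_scheme \<Rightarrow> ('f, 'v) module \<Rightarrow> ('g \<Rightarrow> 'v \<Rightarrow> 'v)
     \<Rightarrow> ('f, ('g list \<Rightarrow> 'v) set) module" where
  "group_cohomology q G V \<rho> =
     quotient_module ((cochains G V q)\<lparr>carrier := cocycles G V \<rho> q\<rparr>) (coboundaries G V \<rho> q)"

definition abelianization :: "('g, 'm) monoid_scheme \<Rightarrow> 'g set monoid" where
  "abelianization G = G Mod derived G (carrier G)"

text \<open>Homomorphisms are additive only; the scalars act on them through the values.\<close>

definition equivariant_homs ::
  "('b, 'm) monoid_scheme \<Rightarrow> ('x, 'k) monoid_scheme \<Rightarrow> ('b \<Rightarrow> 'x \<Rightarrow> 'x)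
     \<Rightarrow> ('f, 'v) module \<Rightarrow> ('b \<Rightarrow> 'v \<Rightarrow> 'v) \<Rightarrow> ('f, 'x \<Rightarrow> 'v) module" where
  "equivariant_homs B A \<alpha> V \<rho> = \<lparr>carrier = {\<phi> \<in> carrier A \<rightarrow>\<^sub>E carrier V.
       \<phi> \<in> hom A (add_monoid V) \<and>
       (\<forall>b\<in>carrier B. \<forall>x\<in>carrier A. \<phi> (\<alpha> b x) = \<rho> b (\<phi> x))},
     mult = undefined, one = undefined,
     zero = (\<lambda>x\<in>carrier A. \<zero>\<^bsub>V\<^esub>),
     add = (\<lambda>\<phi> \<psi>. \<lambda>x\<in>carrier A. \<phi> x \<oplus>\<^bsub>V\<^esub> \<psi> x),
     smult = (\<lambda>a \<phi>. \<lambda>x\<in>carrier A. a \<odot>\<^bsub>V\<^esub> \<phi> x)\<rparr>"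

definition SL :: "'r::comm_ring_1 itself \<Rightarrow> nat \<Rightarrow> 'r mat monoid" where
  "SL ty n = \<lparr>carrier = {A \<in> carrier_mat n n. det A = 1}, mult = (*), one = 1\<^sub>m n\<rparr>"

definition Borel :: "'a::field itself \<Rightarrow> nat \<Rightarrow> 'a mat monoid" where
  "Borel ty n = (SL ty n)\<lparr>carrier := {A \<in> carrier (SL ty n). upper_triangular A}\<rparr>"

definition eval0 :: "'a::comm_ring_1 poly mat \<Rightarrow> 'a mat" where
  "eval0 = map_mat (\<lambda>p. poly p 0)"

definition const_mat :: "'a::comm_ring_1 mat \<Rightarrow> 'a poly mat" where
  "const_mat = map_mat (\<lambda>a. [:a:])"

definition congruence_subgroup :: "'a::field itself \<Rightarrow> nat \<Rightarrow> 'a poly mat set" where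
  "congruence_subgroup ty n = {A \<in> carrier (SL TYPE('a poly) n).
     \<forall>i<n. \<forall>j<n. [:0, 1:] dvd A $$ (i, j) - 1\<^sub>m n $$ (i, j)}"

definition upper_congruence_group :: "'a::field itself \<Rightarrow> nat \<Rightarrow> 'a poly mat monoid" where
  "upper_congruence_group ty n = (SL TYPE('a poly) n)
     \<lparr>carrier := {A \<in> congruence_subgroup ty n. upper_triangular A}\<rparr>"

definition conj_coset :: "nat \<Rightarrow> 'a::field mat \<Rightarrow> 'a poly mat set \<Rightarrow> 'a poly mat set" where
  "conj_coset n b X =
     (\<lambda>c. const_mat b * c * inv\<^bsub>SL TYPE('a poly) n\<^esub> (const_mat b)) ` X"

definition sl_module :: "'a::field itself \<Rightarrow> nat \<Rightarrow> ('a, 'a mat) module" where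
  "sl_module ty n = (module_mat ty n n)
     \<lparr>carrier := {X \<in> carrier_mat n n. (\<Sum>i<n. X $$ (i, i)) = 0}\<rparr>"

definition Ad :: "nat \<Rightarrow> 'a::field mat \<Rightarrow> 'a mat \<Rightarrow> 'a mat" where
  "Ad n g X = g * X * inv\<^bsub>SL TYPE('a) n\<^esub> g"

end

theory Submission
  imports Defs
begin

text \<open>Let \<open>K\<close> be the kernel of \<open>t = 0\<close> on \<open>SL\<^sub>n(F[t])\<close>. A 1-cocycle restricts to a cocycle on the
  constant matrices and to a \<open>B\<close>-equivariant homomorphism \<open>C \<rightarrow> V\<close>, because \<open>K\<close> acts trivially on \<open>V\<close>.
  A cocycle that agrees with a coboundary on the constants and on \<open>C\<close> is that coboundary, since
  these two subgroups generate \<open>SL\<^sub>n(F[t])\<close>.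

  Conversely, every \<open>B\<close>-equivariant \<open>\<psi> : C \<rightarrow> V\<close> is a multiple of \<open>A \<mapsto> A'(0)\<close>. The torus forces
  \<open>\<psi>(1 + p E\<^sub>i\<^sub>j)\<close> to be a multiple \<open>s(p) E\<^sub>i\<^sub>j\<close>; conjugation by the constant unipotents makes \<open>s\<close>
  independent of \<open>(i, j)\<close> and linear over \<open>F\<close>; and commutators give \<open>s(p q) = 0\<close> when \<open>t\<close> divides both
  \<open>p\<close> and \<open>q\<close>. The map \<open>A \<mapsto> A'(0)\<close> extends to the cocycle \<open>A \<mapsto> A'(0) A(0)\<^sup>-\<^sup>1\<close>, so no information
  on the relations of \<open>K\<close> is needed.\<close>

section \<open>Elementary row operations\<close>

text \<open>The elements of \<open>Hom_B(H_1(C), V)\<close> are additive only, so no scalar of F can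
  be taken out of \<open>\<psi>\<close> at the start, and this shapes the argument. The torus is
  used through one element, whose value on the root is the integer 4: since 4 p is a sum of four
  copies of p, additivity alone evaluates \<open>\<psi>\<close> there, and characteristic zero keeps
  4 apart from the values 1, 2, 1/2, 1/4 at the other positions. Linearity over F comes only
  afterwards, from constant unipotents, where a scalar x is a matrix entry and therefore shows up as
  a factor in the equivariance equation. This needs an index strictly between 0 and n - 1, which
  \<open>n \<ge> 3\<close> supplies. The same third index makes the elementary matrices below the
  diagonal commutators.

  The cohomology groups are compared before any quotient is taken on the side of F[t]: restriction
  is a linear map from cocycles onto the direct sum, and its kernel consists of the coboundaries.
  The latter vanish on C because A(0) = 1 there.\<close>

lemma index_mult_mat_sum:
  assumes "A \<in> carrier_mat m n" "B \<in> carrier_mat n k" "i < m" "j < k"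
  shows "(A * B) $$ (i, j) = (\<Sum>l<n. A $$ (i, l) * B $$ (l, j))"
  using assms by (auto simp: scalar_prod_def atLeast0LessThan intro!: sum.cong)

text \<open>Column elimination for a pivot 1 at \<open>(k, k)\<close> with
  \<open>k \<notin> I\<close>. All multipliers are read off from the original matrix. This agrees
  with treating the rows one at a time, because row \<open>k\<close> never changes and row
  \<open>i\<close> is untouched until its turn.\<close>

definition clear_column :: "nat \<Rightarrow> nat set \<Rightarrow> 'r::comm_ring_1 mat \<Rightarrow> 'r mat" where
  "clear_column k I A = mat (dim_row A) (dim_col A)
     (\<lambda>(i, j). if i \<in> I then A $$ (i, j) - A $$ (i, k) * A $$ (k, j) else A $$ (i, j))"

lemma clear_column_insert:
  assumes "A \<in> carrier_mat n n" "k < n" "k \<notin> I" "i \<notin> I" "i \<noteq> k"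
  shows "clear_column k (insert i I) A = addrow (- A $$ (i, k)) i k (clear_column k I A)"
  using assms by (intro eq_matI) (auto simp: clear_column_def algebra_simps)

lemma clear_column_empty: "clear_column k {} A = A"
  by (intro eq_matI) (auto simp: clear_column_def)

text \<open>The invariant \<open>Q\<close> travels forward along the row operations and
  \<open>P\<close> travels backward. The multipliers belong to the original \<open>A\<close> while
  the operations act on the current \<open>B\<close>, hence the mixture of the two in the
  hypotheses.\<close>

lemma clear_column_induct:
  fixes A :: "'r::comm_ring_1 mat"
  assumes A: "A \<in> carrier_mat n n" "k < n" "k \<notin> I" "finite I"
    and "Q A" and Q: "\<And>B i. \<lbrakk>i \<in> I; Q B\<rbrakk> \<Longrightarrow> Q (addrow (- A $$ (i, k)) i k B)"
    and step: "\<And>B i. \<lbrakk>i \<in> I; Q B; P (addrow (- A $$ (i, k)) i k B)\<rbrakk> \<Longrightarrow> P B"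
    and P: "Q (clear_column k I A) \<Longrightarrow> P (clear_column k I A)"
  shows "P A"
proof -
  have "Q (clear_column k J A) \<and> (P (clear_column k J A) \<longrightarrow> P A)" if "J \<subseteq> I" for J
    using finite_subset[OF that A(4)] that
  proof (induction J)
    case empty
    then show ?case using \<open>Q A\<close> by (simp add: clear_column_empty)
  next
    case (insert i J)
    have eq: "clear_column k (insert i J) A = addrow (- A $$ (i, k)) i k (clear_column k J A)"
      using A insert by (intro clear_column_insert) auto
    show ?case
      using insert Q[of i "clear_column k J A"] step[of i "clear_column k J A"]
      unfolding eq by auto
  qed
  then show ?thesis using P by blast
qed

definition unit_columns :: "nat \<Rightarrow> nat \<Rightarrow> 'r::comm_ring_1 mat \<Rightarrow> bool" where
  "unit_columns n k A \<longleftrightarrow> (\<forall>i<n. \<forall>j<k. A $$ (i, j) = (if i = j then 1 else 0))"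

lemma unit_columns_clear:
  assumes "unit_columns n k A" "A \<in> carrier_mat n n" "k < n" "A $$ (k, k) = 1"
    "k \<notin> I" "\<And>i. \<lbrakk>i < n; i \<noteq> k; i \<notin> I\<rbrakk> \<Longrightarrow> A $$ (i, k) = 0"
  shows "unit_columns n (Suc k) (clear_column k I A)"
  using assms by (auto simp: unit_columns_def clear_column_def less_Suc_eq)

lemma unit_columns_addrow:
  assumes "unit_columns n k A" "A \<in> carrier_mat n n" "i < n" "j < n" "k \<le> j" "k \<le> n"
  shows "unit_columns n k (addrow a i j A)"
  using assms by (auto simp: unit_columns_def)

lemma unit_columns_all:
  assumes "unit_columns n n A" "A \<in> carrier_mat n n"
  shows "A = 1\<^sub>m n"
  using assms by (intro eq_matI) (auto simp: unit_columns_def)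

lemma det_addrow_same:
  assumes "A \<in> carrier_mat n n" "i < n" "j < n" "i \<noteq> j"
  shows "det (addrow a i j A) = (det A :: 'r::comm_ring_1)"
proof -
  have "det (addrow a i j A) = det (addrow_mat n a i j * A)"
    using addrow_mat[of A n n j a i] assms by simp
  also have "\<dots> = det A"
    using assms by (subst det_mult[of _ n]) (auto simp: det_addrow_mat)
  finally show ?thesis .
qed

text \<open>Row \<open>k\<close> of the inverse vanishes at the positions \<open>j < k\<close>,
  because the first \<open>k\<close> columns of \<open>A\<close> are unit vectors. So the entry
  \<open>(k, k)\<close> of \<open>B * A\<close> writes 1 as a combination of the entries of column
  \<open>k\<close> from the diagonal down. With \<open>d = 0\<close> this finds a nonzero entry;
  with \<open>d\<close> the only nonzero entry it makes that entry a unit.\<close>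

lemma unit_column_entries_coprime:
  fixes A :: "'r::comm_ring_1 mat"
  assumes A: "A \<in> carrier_mat n n" "det A = 1" and k: "k < n" "unit_columns n k A"
    and d: "\<And>i. \<lbrakk>k \<le> i; i < n\<rbrakk> \<Longrightarrow> d dvd A $$ (i, k)"
  shows "d dvd 1"
proof -
  define B where "B = adj_mat A"
  have B: "B \<in> carrier_mat n n" and BA: "B * A = 1\<^sub>m n"
    using adj_mat[OF A(1)] A(2) by (auto simp: B_def)
  have entry: "(\<Sum>i<n. B $$ (k, i) * A $$ (i, j)) = (if k = j then 1 else 0)" if "j < n" for j
  proof -
    have "(B * A) $$ (k, j) = (\<Sum>i<n. B $$ (k, i) * A $$ (i, j))"
      using A B that k by (intro index_mult_mat_sum) auto
    then show ?thesis using BA that k by simp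
  qed
  have zero: "B $$ (k, j) = 0" if "j < k" for j
  proof -
    have "(\<Sum>i<n. B $$ (k, i) * A $$ (i, j)) = (\<Sum>i<n. if i = j then B $$ (k, i) else 0)"
      using k that by (intro sum.cong) (auto simp: unit_columns_def)
    then show ?thesis using entry[of j] that k by simp
  qed
  have "d dvd (\<Sum>i<n. B $$ (k, i) * A $$ (i, k))"
  proof (intro dvd_sum)
    fix i assume "i \<in> {..<n}"
    then show "d dvd B $$ (k, i) * A $$ (i, k)"
      using d[of i] zero[of i] by (cases "k \<le> i") auto
  qed
  then show ?thesis using entry[OF k(1)] by simp
qed

text \<open>Gaussian elimination by row additions alone, which preserve the determinant. Columns are
  treated from left to right, and the Euclidean algorithm runs inside column \<open>k\<close> on the
  rows from \<open>k\<close> down. The rule passes from \<open>addrow a i j B\<close> back to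
  \<open>B\<close>, so an application only has to undo one elementary operation.\<close>

lemma SL_elementary_induct:
  fixes A :: "'r::euclidean_ring mat"
  assumes A: "A \<in> carrier_mat n n" "det A = 1"
    and one: "P (1\<^sub>m n)"
    and step: "\<And>B a i j. \<lbrakk>B \<in> carrier_mat n n; det B = 1; i < n; j < n; i \<noteq> j;
                 P (addrow a i j B)\<rbrakk> \<Longrightarrow> P B"
  shows "P A"
proof -
  have "P A" if "k \<le> n" "unit_columns n k A" "A \<in> carrier_mat n n" "det A = 1" for k A
    using that
  proof (induction "n - k" arbitrary: k A)
    case 0
    then have "A = 1\<^sub>m n" using unit_columns_all[of n A] by simp
    then show ?case using one by simp
  next
    case (Suc m)
    then have k: "k < n" by simp
    \<comment> \<open>With a pivot 1 the column can be cleared in all other rows and the outer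
      induction takes over. What remains is to produce this pivot.\<close>
    have normalised: "P B" if "unit_columns n k B" "B \<in> carrier_mat n n" "det B = 1"
      "B $$ (k, k) = 1" for B
    proof (rule clear_column_induct[where Q = "\<lambda>B. B \<in> carrier_mat n n \<and> det B = 1" and A = B
          and k = k and I = "{..<n} - {k}"])
      assume *: "clear_column k ({..<n} - {k}) B \<in> carrier_mat n n
        \<and> det (clear_column k ({..<n} - {k}) B) = 1"
      show "P (clear_column k ({..<n} - {k}) B)"
        using * that k Suc.hyps(2)
        by (intro Suc.hyps(1)[of "Suc k"] unit_columns_clear) auto
    qed (use that k in \<open>auto simp: det_addrow_same intro: step\<close>)
    show ?case using Suc.prems
    proof (induction "\<Sum>i\<in>{k..<n}. euclidean_size (A $$ (i, k))" arbitrary: A rule: less_induct)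
      case less
      show ?case
      proof (cases "\<exists>i j. k \<le> i \<and> i < n \<and> k \<le> j \<and> j < n \<and> i \<noteq> j \<and> A $$ (i, k) \<noteq> 0 \<and> A $$ (j, k) \<noteq> 0")
        case True
        then obtain i j where ij: "k \<le> i" "i < n" "k \<le> j" "j < n" "i \<noteq> j"
          "A $$ (i, k) \<noteq> 0" "A $$ (j, k) \<noteq> 0"
          and le: "euclidean_size (A $$ (i, k)) \<le> euclidean_size (A $$ (j, k))"
          by (metis nat_le_linear)
        \<comment> \<open>The larger of two nonzero entries is replaced by its remainder modulo the
          smaller one, so the sum of the Euclidean sizes drops.\<close>
        define B where "B = addrow (- (A $$ (j, k) div A $$ (i, k))) j i A"
        have B: "B \<in> carrier_mat n n" using less by (simp add: B_def)
        have Bjk: "B $$ (j, k) = A $$ (j, k) mod A $$ (i, k)"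
          using less ij k minus_div_mult_eq_mod[of "A $$ (j, k)" "A $$ (i, k)"]
          by (simp add: B_def)
        have Bl: "B $$ (l, k) = A $$ (l, k)" if "l < n" "l \<noteq> j" for l
          using less that k by (simp add: B_def)
        have "(\<Sum>i\<in>{k..<n}. euclidean_size (B $$ (i, k))) < (\<Sum>i\<in>{k..<n}. euclidean_size (A $$ (i, k)))"
        proof (rule sum_strict_mono_ex1)
          have smaller: "euclidean_size (B $$ (j, k)) < euclidean_size (A $$ (j, k))"
            using mod_size_less[OF ij(6), of "A $$ (j, k)"] le by (simp add: Bjk)
          then show "\<exists>l\<in>{k..<n}. euclidean_size (B $$ (l, k)) < euclidean_size (A $$ (l, k))"
            using ij by (intro bexI[of _ j]) auto
          show "\<forall>l\<in>{k..<n}. euclidean_size (B $$ (l, k)) \<le> euclidean_size (A $$ (l, k))"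
          proof
            fix l assume "l \<in> {k..<n}"
            then show "euclidean_size (B $$ (l, k)) \<le> euclidean_size (A $$ (l, k))"
              using Bl[of l] smaller by (cases "l = j") auto
          qed
        qed auto
        then have "P B"
          using less.prems ij B
          by (intro less.hyps) (auto simp: B_def det_addrow_same intro: unit_columns_addrow)
        then show ?thesis
          using step less.prems ij unfolding B_def by blast
      next
        \<comment> \<open>The Euclidean algorithm has ended: a single nonzero entry is left, and
          coprimality makes it a unit.\<close>
        case False
        have "\<exists>i. k \<le> i \<and> i < n \<and> A $$ (i, k) \<noteq> 0"
          using unit_column_entries_coprime[of A n k 0] less.prems k by force
        then obtain i where i: "k \<le> i" "i < n" "A $$ (i, k) \<noteq> 0" by blast
        have zero: "A $$ (j, k) = 0" if "k \<le> j" "j < n" "j \<noteq> i" for j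
          using False i that by blast
        have "is_unit (A $$ (i, k))"
        proof (rule unit_column_entries_coprime[of A n k])
          fix j assume "k \<le> j" "j < n"
          then show "A $$ (i, k) dvd A $$ (j, k)" using zero by (cases "j = i") auto
        qed (use less.prems k in auto)
        then obtain u where u: "u * A $$ (i, k) = 1" by (metis dvdE mult.commute)
        show ?thesis
        proof (cases "i = k")
          case False
          \<comment> \<open>The entry at \<open>(k, k)\<close> is 0 here, so it becomes
            \<open>u * A $$ (i, k)\<close>, which is 1.\<close>
          define B where "B = addrow u k i A"
          have "P B"
            using less.prems i k u zero[of k] False
            by (intro normalised) (auto simp: B_def det_addrow_same intro: unit_columns_addrow)
          then show ?thesis using step less.prems i k unfolding B_def by (metis False)
        next
          case [simp]: True
          show ?thesis
          proof (cases "Suc k < n")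
            case True
            \<comment> \<open>The unit a already sits at the pivot. A copy of it in the next row
              lets the pivot be corrected to a + u a (1 - a) = 1.\<close>
            define B where "B = addrow 1 (Suc k) k A"
            define C where "C = addrow (u * (1 - A $$ (k, k))) k (Suc k) B"
            have B: "B \<in> carrier_mat n n" "det B = 1" "unit_columns n k B"
              using less.prems k True
              by (auto simp: B_def det_addrow_same intro: unit_columns_addrow)
            have "B $$ (Suc k, k) = A $$ (k, k)" "B $$ (k, k) = A $$ (k, k)"
              using less.prems k True zero[of "Suc k"] by (auto simp: B_def)
            then have "C $$ (k, k) = (u * A $$ (k, k)) * (1 - A $$ (k, k)) + A $$ (k, k)"
              using B k by (simp add: C_def algebra_simps)
            then have "P C"
              using B k u True
              by (intro normalised) (auto simp: C_def det_addrow_same intro: unit_columns_addrow)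
            then have "P B" using step B k True unfolding C_def by (metis n_not_Suc_n)
            then show ?thesis using step less.prems k True unfolding B_def by (metis n_not_Suc_n)
          next
            case False
            \<comment> \<open>In the last column there is no further row for the correction, but the
              determinant forces the pivot to be 1.\<close>
            then have n: "n = Suc k" using k by simp
            have "upper_triangular A"
              using less.prems n by (auto simp: upper_triangular_def unit_columns_def less_Suc_eq)
            then have "det A = prod_list (diag_mat A)"
              using less.prems by (intro det_upper_triangular) auto
            also have "\<dots> = (\<Prod>i<Suc k. A $$ (i, i))"
              using less.prems n unfolding prod_list_diag_prod by (simp add: atLeast0LessThan)
            also have "\<dots> = A $$ (k, k)"
              using less.prems n by (simp add: unit_columns_def)
            finally show ?thesis using less.prems by (intro normalised) auto
          qed
        qed
      qed
    qed
  qed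
  from this[of 0 A] A show ?thesis by (simp add: unit_columns_def)
qed

section \<open>Reduction of unitriangular matrices by upper elementary matrices\<close>

definition unitriangular_mod :: "'r::comm_ring_1 \<Rightarrow> nat \<Rightarrow> 'r mat \<Rightarrow> bool" where
  "unitriangular_mod x n A \<longleftrightarrow> A \<in> carrier_mat n n
     \<and> (\<forall>i<n. \<forall>j<n. if i < j then x dvd A $$ (i, j) else A $$ (i, j) = (if i = j then 1 else 0))"

text \<open>The pivots are already 1, so it suffices to clear the entries above the diagonal, and no
  division occurs. The multipliers are themselves entries above the diagonal, hence divisible by
  \<open>x\<close>, and every intermediate matrix stays unitriangular modulo
  \<open>x\<close>.\<close>

lemma unitriangular_elementary_induct:
  assumes A: "unitriangular_mod x n A"
    and one: "P (1\<^sub>m n)"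
    and step: "\<And>B a i j. \<lbrakk>unitriangular_mod x n B; i < j; j < n; x dvd a;
                 P (addrow a i j B)\<rbrakk> \<Longrightarrow> P B"
  shows "P A"
proof -
  have "P A" if "k \<le> n" "unit_columns n k A" "unitriangular_mod x n A" for k A
    using that
  proof (induction "n - k" arbitrary: k A)
    case 0
    then have "A = 1\<^sub>m n" using unit_columns_all[of n A] by (simp add: unitriangular_mod_def)
    then show ?case using one by simp
  next
    case (Suc m)
    then have k: "k < n" by simp
    have A: "A \<in> carrier_mat n n" using Suc by (simp add: unitriangular_mod_def)
    have dvd: "x dvd - A $$ (i, k)" if "i < k" for i
      using Suc.prems k that by (simp add: unitriangular_mod_def)
    show ?case
    proof (rule clear_column_induct[where Q = "unitriangular_mod x n" and A = A
          and k = k and I = "{..<k}"])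
      fix B i assume iB: "i \<in> {..<k}" "unitriangular_mod x n B"
      then show "unitriangular_mod x n (addrow (- A $$ (i, k)) i k B)"
        using dvd[of i] k by (auto simp: unitriangular_mod_def)
      assume "P (addrow (- A $$ (i, k)) i k B)"
      then show "P B" using step[OF iB(2), of i k "- A $$ (i, k)"] iB dvd[of i] k by auto
    next
      assume *: "unitriangular_mod x n (clear_column k {..<k} A)"
      show "P (clear_column k {..<k} A)"
        using * Suc k A
        by (intro Suc.hyps(1)[of "Suc k"] unit_columns_clear) (auto simp: unitriangular_mod_def)
    qed (use Suc k A in auto)
  qed
  from this[of 0 A] A show ?thesis by (simp add: unit_columns_def)
qed

section \<open>Quotient modules\<close>

context
  fixes R :: "('f, 'c) ring_scheme" and M :: "('f, 'v) module" and N :: "'v set"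
  assumes M: "Module.module R M" and N: "LinearCombinations.submodule R N M"
begin

interpretation Module.module R M by (rule M)

lemma submodule_additive_subgroup: "additive_subgroup N M"
proof -
  have N': "N \<subseteq> carrier M" "\<zero>\<^bsub>M\<^esub> \<in> N" "\<And>x y. \<lbrakk>x \<in> N; y \<in> N\<rbrakk> \<Longrightarrow> x \<oplus>\<^bsub>M\<^esub> y \<in> N"
    "\<And>a x. \<lbrakk>a \<in> carrier R; x \<in> N\<rbrakk> \<Longrightarrow> a \<odot>\<^bsub>M\<^esub> x \<in> N"
    using N by (auto simp: LinearCombinations.submodule_def)
  have "\<ominus>\<^bsub>M\<^esub> x \<in> N" if "x \<in> N" for x
    using N'(1) N'(4)[of "\<ominus>\<^bsub>R\<^esub> \<one>\<^bsub>R\<^esub>" x] that smult_l_minus[of "\<one>\<^bsub>R\<^esub>" x] by (auto simp: subset_iff)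
  with N' have "subgroup N (add_monoid M)"
    by unfold_locales (auto simp: a_inv_def[symmetric])
  then show ?thesis by (rule additive_subgroup.intro)
qed

interpretation abelian_subgroup N M
  by (rule abelian_subgroupI3[OF submodule_additive_subgroup]) unfold_locales

lemma quotient_module_add:
  assumes "x \<in> carrier M" "y \<in> carrier M"
  shows "(N +>\<^bsub>M\<^esub> x) \<oplus>\<^bsub>quotient_module M N\<^esub> (N +>\<^bsub>M\<^esub> y) = N +>\<^bsub>M\<^esub> (x \<oplus>\<^bsub>M\<^esub> y)"
  using a_rcos_sum[OF assms] by (simp add: quotient_module_def)

text \<open>Scalar multiplication on the quotient is a union over all representatives of a coset. It
  collapses to one coset because all representatives give the same one and there is at least one of
  them.\<close>

lemma quotient_module_smult:
  assumes "a \<in> carrier R" "x \<in> carrier M"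
  shows "a \<odot>\<^bsub>quotient_module M N\<^esub> (N +>\<^bsub>M\<^esub> x) = N +>\<^bsub>M\<^esub> (a \<odot>\<^bsub>M\<^esub> x)"
proof -
  have *: "N +>\<^bsub>M\<^esub> (a \<odot>\<^bsub>M\<^esub> y) = N +>\<^bsub>M\<^esub> (a \<odot>\<^bsub>M\<^esub> x)" if y: "y \<in> N +>\<^bsub>M\<^esub> x" for y
  proof (rule a_repr_independence'[symmetric])
    obtain n where n: "n \<in> N" "y = n \<oplus>\<^bsub>M\<^esub> x" using y by (auto simp: a_r_coset_def')
    then have "a \<odot>\<^bsub>M\<^esub> y = a \<odot>\<^bsub>M\<^esub> n \<oplus>\<^bsub>M\<^esub> a \<odot>\<^bsub>M\<^esub> x"
      using assms a_subset by (auto simp: smult_r_distr)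
    moreover have "a \<odot>\<^bsub>M\<^esub> n \<in> N" using N n assms by (auto simp: LinearCombinations.submodule_def)
    ultimately show "a \<odot>\<^bsub>M\<^esub> y \<in> N +>\<^bsub>M\<^esub> (a \<odot>\<^bsub>M\<^esub> x)" by (auto simp: a_r_coset_def')
  qed (use assms in auto)
  have "N +>\<^bsub>M\<^esub> x \<noteq> {}" using a_rcos_self assms(2) by blast
  moreover have "(\<Union>y\<in>N +>\<^bsub>M\<^esub> x. N +>\<^bsub>M\<^esub> (a \<odot>\<^bsub>M\<^esub> y)) = (\<Union>y\<in>N +>\<^bsub>M\<^esub> x. N +>\<^bsub>M\<^esub> (a \<odot>\<^bsub>M\<^esub> x))"
    by (rule SUP_cong[OF refl *])
  ultimately show ?thesis by (simp add: quotient_module_def)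
qed

lemma carrier_quotient_module:
  "carrier (quotient_module M N) = (\<lambda>x. N +>\<^bsub>M\<^esub> x) ` carrier M"
  by (auto simp: quotient_module_def A_RCOSETS_def')

lemma quotient_module_iso:
  assumes h: "h \<in> LinearCombinations.module_hom R M P"
    and surj: "h ` carrier M = carrier P"
    and ker: "\<And>x. x \<in> carrier M \<Longrightarrow> h x = h \<zero>\<^bsub>M\<^esub> \<longleftrightarrow> x \<in> N"
  shows "isomorphic_modules R (quotient_module M N) P"
proof -
  note h_add = LinearCombinations.module_hom_add[OF h]
  note h_smult = LinearCombinations.module_hom_smult[OF h]
  note h_closed = funcset_mem[OF LinearCombinations.module_hom_closed[OF h]]
  define \<Phi> where "\<Phi> X = h (SOME x. x \<in> X)" for X
  have \<Phi>: "\<Phi> (N +>\<^bsub>M\<^esub> x) = h x" if x: "x \<in> carrier M" for x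
  proof -
    have "(SOME y. y \<in> N +>\<^bsub>M\<^esub> x) \<in> N +>\<^bsub>M\<^esub> x"
      using a_rcos_self[OF x] by (rule someI)
    then obtain n where n: "n \<in> N" "(SOME y. y \<in> N +>\<^bsub>M\<^esub> x) = n \<oplus>\<^bsub>M\<^esub> x"
      by (auto simp: a_r_coset_def')
    have "h (n \<oplus>\<^bsub>M\<^esub> x) = h n \<oplus>\<^bsub>P\<^esub> h x" using n x a_subset by (intro h_add) auto
    also have "h n = h \<zero>\<^bsub>M\<^esub>" using ker n a_subset by blast
    also have "h \<zero>\<^bsub>M\<^esub> \<oplus>\<^bsub>P\<^esub> h x = h x" unfolding h_add[OF M.zero_closed x, symmetric] using x by simp
    finally show ?thesis unfolding \<Phi>_def n(2) .
  qed
  note carr = carrier_quotient_module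
  have "\<Phi> \<in> LinearCombinations.module_hom R (quotient_module M N) P"
    unfolding LinearCombinations.module_hom_def carr
    by (intro CollectI conjI funcsetI allI impI; elim conjE imageE)
      (simp_all add: \<Phi> quotient_module_add quotient_module_smult h_add h_smult h_closed)
  moreover have "inj_on \<Phi> (carrier (quotient_module M N))"
  proof (rule inj_onI)
    fix X Y assume X: "X \<in> carrier (quotient_module M N)" and Y: "Y \<in> carrier (quotient_module M N)"
      and eq: "\<Phi> X = \<Phi> Y"
    obtain x where x: "x \<in> carrier M" "X = N +>\<^bsub>M\<^esub> x" using X unfolding carr by (rule imageE)
    obtain y where y: "y \<in> carrier M" "Y = N +>\<^bsub>M\<^esub> y" using Y unfolding carr by (rule imageE)
    have y': "\<ominus>\<^bsub>M\<^esub> y \<in> carrier M" using y(1) by (rule M.a_inv_closed)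
    have "h x = h y" using eq unfolding x(2) y(2) \<Phi>[OF x(1)] \<Phi>[OF y(1)] .
    then have "h (x \<oplus>\<^bsub>M\<^esub> \<ominus>\<^bsub>M\<^esub> y) = h (y \<oplus>\<^bsub>M\<^esub> \<ominus>\<^bsub>M\<^esub> y)"
      unfolding h_add[OF x(1) y'] h_add[OF y(1) y'] by (rule arg_cong)
    then have "h (x \<oplus>\<^bsub>M\<^esub> \<ominus>\<^bsub>M\<^esub> y) = h \<zero>\<^bsub>M\<^esub>" unfolding M.r_neg[OF y(1)] .
    then have "x \<oplus>\<^bsub>M\<^esub> \<ominus>\<^bsub>M\<^esub> y \<in> N" using ker[OF M.a_closed[OF x(1) y']] by blast
    then have "x \<in> N +>\<^bsub>M\<^esub> y" using a_rcos_module[OF y(1) x(1)] by blast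
    then show "X = Y" unfolding x(2) y(2) by (rule a_repr_independence'[OF _ y(1), symmetric])
  qed
  moreover have "\<Phi> ` carrier (quotient_module M N) = carrier P"
    unfolding carr image_image surj[symmetric] by (intro image_cong refl \<Phi>)
  ultimately show ?thesis unfolding isomorphic_modules_def bij_betw_def by blast
qed

end

section \<open>First cohomology\<close>

lemma tuples_1: "tuples G (Suc 0) = (\<lambda>g. [g]) ` carrier G"
  by (auto simp: tuples_def length_Suc_conv image_iff)

lemma tuples_2: "gs \<in> tuples G (Suc (Suc 0)) \<longleftrightarrow> (\<exists>g\<in>carrier G. \<exists>h\<in>carrier G. gs = [g, h])"
  by (auto simp: tuples_def length_Suc_conv)

lemma tuples_0: "tuples G 0 = {[]}"
  by (auto simp: tuples_def)

lemma carrier_cochains_1: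
  "f \<in> carrier (cochains G V (Suc 0)) \<longleftrightarrow>
     (\<forall>g\<in>carrier G. f [g] \<in> carrier V) \<and> f \<in> extensional (tuples G (Suc 0))"
  by (auto simp: cochains_def tuples_1 PiE_def)

lemma cochain_1_eqI:
  assumes "f \<in> extensional (tuples G (Suc 0))" "h \<in> extensional (tuples G (Suc 0))"
    and "\<And>g. g \<in> carrier G \<Longrightarrow> f [g] = h [g]"
  shows "f = h"
  using assms by (intro extensionalityI[of f "tuples G (Suc 0)"]) (auto simp: tuples_1)

lemma (in abelian_group) minus_eq_zero_iff:
  assumes "x \<in> carrier G" "y \<in> carrier G"
  shows "x \<ominus> y = \<zero> \<longleftrightarrow> x = y"
  using assms minus_equality[of x "\<ominus> y"] by (auto simp: minus_eq r_neg)

lemma cochains_simps: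
  "zero (cochains G V q) = (\<lambda>gs\<in>tuples G q. \<zero>\<^bsub>V\<^esub>)"
  "add (cochains G V q) f h = (\<lambda>gs\<in>tuples G q. f gs \<oplus>\<^bsub>V\<^esub> h gs)"
  "smult (cochains G V q) a f = (\<lambda>gs\<in>tuples G q. a \<odot>\<^bsub>V\<^esub> f gs)"
  by (auto simp: cochains_def)

lemma cochains_module:
  fixes V :: "('f, 'v) module"
  assumes "Module.module R V"
  shows "Module.module R (cochains G V q)"
proof -
  interpret Module.module R V by fact
  show ?thesis
  proof (rule moduleI)
    show "abelian_group (cochains G V q)"
    proof (rule abelian_groupI)
      fix f assume f: "f \<in> carrier (cochains G V q)"
      then have "(\<lambda>gs\<in>tuples G q. \<ominus>\<^bsub>V\<^esub> f gs) \<in> carrier (cochains G V q)"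
        "(\<lambda>gs\<in>tuples G q. \<ominus>\<^bsub>V\<^esub> f gs) \<oplus>\<^bsub>cochains G V q\<^esub> f = \<zero>\<^bsub>cochains G V q\<^esub>"
        by (auto simp: cochains_def PiE_iff M.l_neg intro!: restrict_ext)
      then show "\<exists>h\<in>carrier (cochains G V q). h \<oplus>\<^bsub>cochains G V q\<^esub> f = \<zero>\<^bsub>cochains G V q\<^esub>" by blast
    next
      fix f assume f: "f \<in> carrier (cochains G V q)"
      then show "\<zero>\<^bsub>cochains G V q\<^esub> \<oplus>\<^bsub>cochains G V q\<^esub> f = f"
        by (intro extensionalityI[of _ "tuples G q"]) (auto simp: cochains_def PiE_iff)
    qed (auto simp: cochains_def PiE_iff M.a_ac intro!: restrict_ext)
    show "\<one>\<^bsub>R\<^esub> \<odot>\<^bsub>cochains G V q\<^esub> f = f" if "f \<in> carrier (cochains G V q)" for f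
      using that by (intro extensionalityI[of _ "tuples G q"]) (auto simp: cochains_def PiE_iff)
    show "cring R" ..
  qed (auto simp: cochains_def PiE_iff smult_l_distr smult_r_distr smult_assoc1 intro!: restrict_ext)
qed

section \<open>Cocycles and coboundaries of degree 1 for a linear representation\<close>

locale linear_representation = G?: Group.group G + Module.module R V
  for G :: "('g, 'm) monoid_scheme" and R :: "('f, 'c) ring_scheme" and V :: "('f, 'v) module" +
  fixes \<rho> :: "'g \<Rightarrow> 'v \<Rightarrow> 'v"
  assumes action_closed: "\<lbrakk>g \<in> carrier G; v \<in> carrier V\<rbrakk> \<Longrightarrow> \<rho> g v \<in> carrier V"
    and action_add: "\<lbrakk>g \<in> carrier G; v \<in> carrier V; w \<in> carrier V\<rbrakk>
      \<Longrightarrow> \<rho> g (v \<oplus>\<^bsub>V\<^esub> w) = \<rho> g v \<oplus>\<^bsub>V\<^esub> \<rho> g w"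
    and action_smult: "\<lbrakk>g \<in> carrier G; v \<in> carrier V; a \<in> carrier R\<rbrakk>
      \<Longrightarrow> \<rho> g (a \<odot>\<^bsub>V\<^esub> v) = a \<odot>\<^bsub>V\<^esub> \<rho> g v"
    and action_mult: "\<lbrakk>g \<in> carrier G; h \<in> carrier G; v \<in> carrier V\<rbrakk>
      \<Longrightarrow> \<rho> (g \<otimes>\<^bsub>G\<^esub> h) v = \<rho> g (\<rho> h v)"
    and action_one: "v \<in> carrier V \<Longrightarrow> \<rho> \<one>\<^bsub>G\<^esub> v = v"
begin

lemma action_zero: "g \<in> carrier G \<Longrightarrow> \<rho> g \<zero>\<^bsub>V\<^esub> = \<zero>\<^bsub>V\<^esub>"
  using action_smult[of g "\<zero>\<^bsub>V\<^esub>" "\<zero>\<^bsub>R\<^esub>"] action_closed[of g "\<zero>\<^bsub>V\<^esub>"] by simp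

lemma action_minus: "\<lbrakk>g \<in> carrier G; v \<in> carrier V\<rbrakk> \<Longrightarrow> \<rho> g (\<ominus>\<^bsub>V\<^esub> v) = \<ominus>\<^bsub>V\<^esub> \<rho> g v"
  using action_add[of g "\<ominus>\<^bsub>V\<^esub> v" v]
  by (intro M.minus_equality[symmetric]) (auto simp: action_closed action_zero M.l_neg)

lemma cocycles_1:
  "f \<in> cocycles G V \<rho> (Suc 0) \<longleftrightarrow> f \<in> carrier (cochains G V (Suc 0)) \<and>
     (\<forall>g\<in>carrier G. \<forall>h\<in>carrier G. f [g \<otimes>\<^bsub>G\<^esub> h] = f [g] \<oplus>\<^bsub>V\<^esub> \<rho> g (f [h]))"
proof (cases "f \<in> carrier (cochains G V (Suc 0))")
  case True
  then have f: "f [g] \<in> carrier V" if "g \<in> carrier G" for g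
    using that by (auto simp: carrier_cochains_1)
  \<comment> \<open>For q = 1 the middle sum has the single term i = 0, of sign -1, and the last
    term has sign +1.\<close>
  have eq: "coboundary_map G V \<rho> (Suc 0) f [g, h] = (\<rho> g (f [h]) \<oplus>\<^bsub>V\<^esub> \<ominus>\<^bsub>V\<^esub> f [g \<otimes>\<^bsub>G\<^esub> h]) \<oplus>\<^bsub>V\<^esub> f [g]"
    if "g \<in> carrier G" "h \<in> carrier G" for g h
    using f that
    by (simp add: coboundary_map_def tuples_2 alternate_def merge_at_def lessThan_Suc)
  have "coboundary_map G V \<rho> (Suc 0) f [g, h] = \<zero>\<^bsub>V\<^esub> \<longleftrightarrow> f [g \<otimes>\<^bsub>G\<^esub> h] = f [g] \<oplus>\<^bsub>V\<^esub> \<rho> g (f [h])"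
    if "g \<in> carrier G" "h \<in> carrier G" for g h
  proof -
    have c: "f [g] \<in> carrier V" "\<rho> g (f [h]) \<in> carrier V" "f [g \<otimes>\<^bsub>G\<^esub> h] \<in> carrier V"
      using f that action_closed by auto
    have "coboundary_map G V \<rho> (Suc 0) f [g, h] = (f [g] \<oplus>\<^bsub>V\<^esub> \<rho> g (f [h])) \<ominus>\<^bsub>V\<^esub> f [g \<otimes>\<^bsub>G\<^esub> h]"
      using eq[OF that] c by (simp add: M.minus_eq M.a_ac)
    then show ?thesis using M.minus_eq_zero_iff[OF M.add.m_closed[OF c(1,2)] c(3)] by auto
  qed
  moreover have "coboundary_map G V \<rho> (Suc 0) f = \<zero>\<^bsub>cochains G V (Suc (Suc 0))\<^esub> \<longleftrightarrow>
    (\<forall>g\<in>carrier G. \<forall>h\<in>carrier G. coboundary_map G V \<rho> (Suc 0) f [g, h] = \<zero>\<^bsub>V\<^esub>)"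
  proof
    assume *: "\<forall>g\<in>carrier G. \<forall>h\<in>carrier G. coboundary_map G V \<rho> (Suc 0) f [g, h] = \<zero>\<^bsub>V\<^esub>"
    show "coboundary_map G V \<rho> (Suc 0) f = \<zero>\<^bsub>cochains G V (Suc (Suc 0))\<^esub>"
    proof (rule extensionalityI[of _ "tuples G (Suc (Suc 0))"])
      fix gs assume gs: "gs \<in> tuples G (Suc (Suc 0))"
      then show "coboundary_map G V \<rho> (Suc 0) f gs = \<zero>\<^bsub>cochains G V (Suc (Suc 0))\<^esub> gs"
        using * by (auto simp: cochains_simps tuples_2)
    qed (auto simp: coboundary_map_def cochains_simps)
  qed (auto simp: cochains_simps tuples_2)
  ultimately show ?thesis using True by (simp add: cocycles_def)
qed (simp add: cocycles_def)

lemma coboundaries_1: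
  "f \<in> coboundaries G V \<rho> (Suc 0) \<longleftrightarrow> f \<in> extensional (tuples G (Suc 0)) \<and>
     (\<exists>v\<in>carrier V. \<forall>g\<in>carrier G. f [g] = \<rho> g v \<ominus>\<^bsub>V\<^esub> v)"
proof -
  \<comment> \<open>For q = 0 the middle sum is empty, the last term has sign -1, and a cochain
    amounts to its value at the empty list.\<close>
  have eq: "coboundary_map G V \<rho> 0 c = (\<lambda>gs\<in>tuples G (Suc 0). \<rho> (hd gs) (c []) \<ominus>\<^bsub>V\<^esub> c [])"
    if "c [] \<in> carrier V" for c
    using that unfolding coboundary_map_def
    by (auto simp: tuples_1 alternate_def action_closed M.minus_eq intro!: restrict_ext)
  show ?thesis
  proof
    assume "f \<in> coboundaries G V \<rho> (Suc 0)"
    then obtain c where c: "c \<in> carrier (cochains G V 0)" "f = coboundary_map G V \<rho> 0 c"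
      by auto
    then have "c [] \<in> carrier V" by (auto simp: cochains_def tuples_0)
    then show "f \<in> extensional (tuples G (Suc 0)) \<and>
        (\<exists>v\<in>carrier V. \<forall>g\<in>carrier G. f [g] = \<rho> g v \<ominus>\<^bsub>V\<^esub> v)"
      unfolding c(2) by (intro conjI bexI[of _ "c []"] ballI) (simp_all add: eq tuples_1)
  next
    assume f: "f \<in> extensional (tuples G (Suc 0)) \<and>
        (\<exists>v\<in>carrier V. \<forall>g\<in>carrier G. f [g] = \<rho> g v \<ominus>\<^bsub>V\<^esub> v)"
    then obtain v where v: "v \<in> carrier V" "\<forall>g\<in>carrier G. f [g] = \<rho> g v \<ominus>\<^bsub>V\<^esub> v"
      by (elim conjE bexE)
    define c where "c = (\<lambda>gs\<in>tuples G 0. v)"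
    have c: "c \<in> carrier (cochains G V 0)" "c [] = v"
      using v(1) by (auto simp: c_def cochains_def tuples_0)
    have "f = coboundary_map G V \<rho> 0 c"
      unfolding eq[of c, unfolded c(2), OF v(1)] using f v(2)
      by (intro cochain_1_eqI[of f G]) (simp_all add: tuples_1)
    then show "f \<in> coboundaries G V \<rho> (Suc 0)" using c(1) by simp
  qed
qed

lemma cocycles_1_submodule:
  "LinearCombinations.submodule R (cocycles G V \<rho> (Suc 0)) (cochains G V (Suc 0))"
proof (rule LinearCombinations.submodule.intro)
  show "Module.module R (cochains G V (Suc 0))" by (rule cochains_module) unfold_locales
  show "\<zero>\<^bsub>cochains G V (Suc 0)\<^esub> \<in> cocycles G V \<rho> (Suc 0)"
    unfolding cocycles_1 by (auto simp: carrier_cochains_1 cochains_simps tuples_1 action_zero)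
next
  fix f h assume "f \<in> cocycles G V \<rho> (Suc 0)" "h \<in> cocycles G V \<rho> (Suc 0)"
  then show "f \<oplus>\<^bsub>cochains G V (Suc 0)\<^esub> h \<in> cocycles G V \<rho> (Suc 0)"
    unfolding cocycles_1 by (auto simp: carrier_cochains_1 cochains_simps tuples_1 action_add
        action_closed M.a_ac)
next
  fix a f assume "a \<in> carrier R" "f \<in> cocycles G V \<rho> (Suc 0)"
  then show "a \<odot>\<^bsub>cochains G V (Suc 0)\<^esub> f \<in> cocycles G V \<rho> (Suc 0)"
    unfolding cocycles_1 by (auto simp: carrier_cochains_1 cochains_simps tuples_1 action_smult
        action_closed smult_r_distr)
qed (simp add: cocycles_def subset_iff)

lemma cocycle_module: "Module.module R ((cochains G V (Suc 0))\<lparr>carrier := cocycles G V \<rho> (Suc 0)\<rparr>)"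
proof -
  interpret C: Module.module R "cochains G V (Suc 0)" by (rule cochains_module) unfold_locales
  show ?thesis by (rule C.submodule_is_module[OF cocycles_1_submodule])
qed

lemma coboundaries_1_submodule:
  "LinearCombinations.submodule R (coboundaries G V \<rho> (Suc 0))
     ((cochains G V (Suc 0))\<lparr>carrier := cocycles G V \<rho> (Suc 0)\<rparr>)"
proof (rule LinearCombinations.submodule.intro)
  show "Module.module R ((cochains G V (Suc 0))\<lparr>carrier := cocycles G V \<rho> (Suc 0)\<rparr>)" by (rule cocycle_module)
  show "coboundaries G V \<rho> (Suc 0) \<subseteq> carrier ((cochains G V (Suc 0))\<lparr>carrier := cocycles G V \<rho> (Suc 0)\<rparr>)"
  proof
    fix f assume "f \<in> coboundaries G V \<rho> (Suc 0)"
    then obtain v where v: "v \<in> carrier V" "f \<in> extensional (tuples G (Suc 0))"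
      "\<And>g. g \<in> carrier G \<Longrightarrow> f [g] = \<rho> g v \<ominus>\<^bsub>V\<^esub> v"
      unfolding coboundaries_1 by blast
    have "f [g \<otimes>\<^bsub>G\<^esub> h] = f [g] \<oplus>\<^bsub>V\<^esub> \<rho> g (f [h])" if "g \<in> carrier G" "h \<in> carrier G" for g h
    proof -
      have "f [g] \<oplus>\<^bsub>V\<^esub> \<rho> g (f [h]) = (\<rho> g v \<oplus>\<^bsub>V\<^esub> \<ominus>\<^bsub>V\<^esub> v) \<oplus>\<^bsub>V\<^esub> (\<rho> g (\<rho> h v) \<oplus>\<^bsub>V\<^esub> \<ominus>\<^bsub>V\<^esub> \<rho> g v)"
        using that v by (simp add: M.minus_eq action_add action_closed action_minus)
      also have "\<dots> = \<rho> g (\<rho> h v) \<oplus>\<^bsub>V\<^esub> \<ominus>\<^bsub>V\<^esub> v"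
        using that v by (simp add: M.a_ac action_closed M.r_neg1 M.r_neg2 M.l_neg M.r_neg)
      finally show ?thesis using that v by (simp add: M.minus_eq action_mult)
    qed
    then show "f \<in> carrier ((cochains G V (Suc 0))\<lparr>carrier := cocycles G V \<rho> (Suc 0)\<rparr>)"
      using v by (auto simp: cocycles_1 carrier_cochains_1 action_closed)
  qed
  show "\<zero>\<^bsub>(cochains G V (Suc 0))\<lparr>carrier := cocycles G V \<rho> (Suc 0)\<rparr>\<^esub> \<in> coboundaries G V \<rho> (Suc 0)"
    unfolding coboundaries_1
    by (auto simp: cochains_simps tuples_1 action_zero M.minus_eq M.r_neg intro!: bexI[of _ "\<zero>\<^bsub>V\<^esub>"])
next
  fix f h assume "f \<in> coboundaries G V \<rho> (Suc 0)" "h \<in> coboundaries G V \<rho> (Suc 0)"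
  then obtain v w where v: "v \<in> carrier V" "\<And>g. g \<in> carrier G \<Longrightarrow> f [g] = \<rho> g v \<ominus>\<^bsub>V\<^esub> v"
    and w: "w \<in> carrier V" "\<And>g. g \<in> carrier G \<Longrightarrow> h [g] = \<rho> g w \<ominus>\<^bsub>V\<^esub> w"
    unfolding coboundaries_1 by blast
  have "f [g] \<oplus>\<^bsub>V\<^esub> h [g] = \<rho> g (v \<oplus>\<^bsub>V\<^esub> w) \<ominus>\<^bsub>V\<^esub> (v \<oplus>\<^bsub>V\<^esub> w)" if g: "g \<in> carrier G" for g
  proof -
    have c: "\<rho> g v \<in> carrier V" "\<rho> g w \<in> carrier V" using g v w action_closed by blast+
    show ?thesis
      unfolding v(2)[OF g] w(2)[OF g] action_add[OF g v(1) w(1)] M.minus_eq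
      using c v(1) w(1) by (simp add: M.minus_add M.a_ac)
  qed
  then show "f \<oplus>\<^bsub>(cochains G V (Suc 0))\<lparr>carrier := cocycles G V \<rho> (Suc 0)\<rparr>\<^esub> h
      \<in> coboundaries G V \<rho> (Suc 0)"
    unfolding coboundaries_1
    by (intro conjI bexI[OF _ M.a_closed[OF v(1) w(1)]]) (simp_all add: cochains_simps tuples_1)
next
  fix a f assume a: "a \<in> carrier R" and "f \<in> coboundaries G V \<rho> (Suc 0)"
  then obtain v where v: "v \<in> carrier V" "\<And>g. g \<in> carrier G \<Longrightarrow> f [g] = \<rho> g v \<ominus>\<^bsub>V\<^esub> v"
    unfolding coboundaries_1 by blast
  have "a \<odot>\<^bsub>V\<^esub> f [g] = \<rho> g (a \<odot>\<^bsub>V\<^esub> v) \<ominus>\<^bsub>V\<^esub> (a \<odot>\<^bsub>V\<^esub> v)" if g: "g \<in> carrier G" for g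
  proof -
    have c: "\<rho> g v \<in> carrier V" using g v action_closed by blast
    show ?thesis
      unfolding v(2)[OF g] action_smult[OF g v(1) a] M.minus_eq
      using a c v(1) by (simp add: smult_r_distr smult_r_minus)
  qed
  then show "a \<odot>\<^bsub>(cochains G V (Suc 0))\<lparr>carrier := cocycles G V \<rho> (Suc 0)\<rparr>\<^esub> f
      \<in> coboundaries G V \<rho> (Suc 0)"
    unfolding coboundaries_1
    by (intro conjI bexI[OF _ smult_closed[OF a v(1)]]) (simp_all add: cochains_simps tuples_1)
qed

lemma cocycle_closed:
  "\<lbrakk>f \<in> cocycles G V \<rho> (Suc 0); g \<in> carrier G\<rbrakk> \<Longrightarrow> f [g] \<in> carrier V"
  unfolding cocycles_1 carrier_cochains_1 by (elim conjE) (rule bspec)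

lemma cocycle_mult:
  "\<lbrakk>f \<in> cocycles G V \<rho> (Suc 0); g \<in> carrier G; h \<in> carrier G\<rbrakk>
     \<Longrightarrow> f [g \<otimes>\<^bsub>G\<^esub> h] = f [g] \<oplus>\<^bsub>V\<^esub> \<rho> g (f [h])"
  unfolding cocycles_1 by (elim conjE) (drule (1) bspec, drule (1) bspec)

lemma cocycle_one:
  assumes "f \<in> cocycles G V \<rho> (Suc 0)"
  shows "f [\<one>\<^bsub>G\<^esub>] = \<zero>\<^bsub>V\<^esub>"
proof -
  have f: "f [\<one>\<^bsub>G\<^esub>] \<in> carrier V"
    by (rule cocycle_closed[OF assms G.one_closed])
  have "f [\<one>\<^bsub>G\<^esub>] = f [\<one>\<^bsub>G\<^esub>] \<oplus>\<^bsub>V\<^esub> f [\<one>\<^bsub>G\<^esub>]"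
    using cocycle_mult[OF assms G.one_closed G.one_closed]
    unfolding G.r_one[OF G.one_closed] action_one[OF f] .
  then show ?thesis by (rule iffD1[OF M.add.l_cancel_one'[OF f f]])
qed

lemma cocycle_inv:
  assumes f: "f \<in> cocycles G V \<rho> (Suc 0)" and g: "g \<in> carrier G"
  shows "f [inv\<^bsub>G\<^esub> g] = \<ominus>\<^bsub>V\<^esub> \<rho> (inv\<^bsub>G\<^esub> g) (f [g])"
proof (rule M.minus_equality[symmetric])
  show "f [inv\<^bsub>G\<^esub> g] \<oplus>\<^bsub>V\<^esub> \<rho> (inv\<^bsub>G\<^esub> g) (f [g]) = \<zero>\<^bsub>V\<^esub>"
    using cocycle_mult[OF f G.inv_closed[OF g] g, symmetric]
    unfolding G.l_inv[OF g] cocycle_one[OF f] .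
qed (use f g in \<open>auto intro: cocycle_closed action_closed\<close>)

end

section \<open>Special linear groups and the adjoint representation\<close>

lemma addrow_mat_add:
  fixes a b :: "'r::comm_ring_1"
  assumes "i < n" "j < n" "i \<noteq> j"
  shows "addrow_mat n a i j * addrow_mat n b i j = addrow_mat n (a + b) i j"
  using assms unfolding addrow_mat[OF addrow_mat_carrier assms(2), symmetric]
  by (intro eq_matI) auto

lemma addrow_mat_zero: "addrow_mat n 0 i j = 1\<^sub>m n"
  by (intro eq_matI) auto

text \<open>The Steinberg relation [e_ij(a), e_jk(b)] = e_ik(a b), multiplied out so that no inverse
  occurs. Both sides can then be compared by row operations, and a homomorphism can be applied to
  them factor by factor.\<close>

lemma addrow_mat_commutator:
  fixes a b :: "'r::comm_ring_1"
  assumes "i < n" "j < n" "k < n" "i \<noteq> j" "j \<noteq> k" "i \<noteq> k"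
  shows "addrow_mat n a i j * addrow_mat n b j k =
    addrow_mat n (a * b) i k * (addrow_mat n b j k * addrow_mat n a i j)"
proof -
  have "addrow_mat n a i j * addrow_mat n b j k = addrow a i j (addrow_mat n b j k)"
    using assms by (intro addrow_mat[symmetric]) auto
  also have "\<dots> = addrow (a * b) i k (addrow b j k (addrow_mat n a i j))"
    using assms by (intro eq_matI) auto
  also have "\<dots> = addrow_mat n (a * b) i k * (addrow_mat n b j k * addrow_mat n a i j)"
    using assms by (subst (1 2) addrow_mat[of _ n n]) auto
  finally show ?thesis .
qed

text \<open>The same relation for the opposite order of the two factors. It serves to move a
  constant e_jk(b) from the left of e_ij(a) to its right.\<close>

lemma addrow_mat_commutator':
  fixes a b :: "'r::comm_ring_1"
  assumes "i < n" "j < n" "k < n" "i \<noteq> j" "j \<noteq> k" "i \<noteq> k"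
  shows "addrow_mat n b j k * addrow_mat n a i j =
    (addrow_mat n (- (a * b)) i k * addrow_mat n a i j) * addrow_mat n b j k"
proof -
  have "addrow_mat n b j k * addrow_mat n a i j = addrow b j k (addrow_mat n a i j)"
    using assms by (intro addrow_mat[symmetric]) auto
  also have "\<dots> = addrow (- (a * b)) i k (addrow a i j (addrow_mat n b j k))"
    using assms by (intro eq_matI) auto
  also have "\<dots> = addrow_mat n (- (a * b)) i k * (addrow_mat n a i j * addrow_mat n b j k)"
    using assms by (subst (1 2) addrow_mat[of _ n n]) auto
  finally show ?thesis by (simp add: assoc_mult_mat[of _ n n _ n _ n])
qed

section \<open>Special linear groups, constant matrices and evaluation at 0\<close>

lemma SL_simps [simp]:
  "A \<in> carrier (SL ty n) \<longleftrightarrow> A \<in> carrier_mat n n \<and> det A = 1"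
  "A \<otimes>\<^bsub>SL ty n\<^esub> B = A * B"
  "\<one>\<^bsub>SL ty n\<^esub> = 1\<^sub>m n"
  by (auto simp: SL_def)

lemma SL_group:
  fixes ty :: "'a::comm_ring_1 itself"
  shows "Group.group (SL ty n)"
proof (rule groupI)
  fix A assume "A \<in> carrier (SL ty n)"
  then have A: "A \<in> carrier_mat n n" "det A = 1" by auto
  note adj = adj_mat[OF A(1)]
  have "1 \<cdot>\<^sub>m 1\<^sub>m n = (1\<^sub>m n :: 'a mat)" by (intro eq_matI) auto
  then have "adj_mat A * A = 1\<^sub>m n" using adj A by simp
  moreover have "det (adj_mat A) = 1"
    using det_mult[OF adj(1) A(1)] adj A by simp
  ultimately show "\<exists>B\<in>carrier (SL ty n). B \<otimes>\<^bsub>SL ty n\<^esub> A = \<one>\<^bsub>SL ty n\<^esub>"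
    using adj(1) by (intro bexI[of _ "adj_mat A"]) auto
qed (auto simp: det_mult[of _ n] assoc_mult_mat[of _ n n _ n _ n])

lemma SL_inv_carrier:
  assumes "A \<in> carrier_mat n n" "det A = 1"
  shows "inv\<^bsub>SL ty n\<^esub> A \<in> carrier_mat n n" "det (inv\<^bsub>SL ty n\<^esub> A) = 1"
    "inv\<^bsub>SL ty n\<^esub> A * A = 1\<^sub>m n" "A * inv\<^bsub>SL ty n\<^esub> A = 1\<^sub>m n"
proof -
  interpret Group.group "SL ty n" by (rule SL_group)
  have A: "A \<in> carrier (SL ty n)" using assms by simp
  show "inv\<^bsub>SL ty n\<^esub> A \<in> carrier_mat n n" "det (inv\<^bsub>SL ty n\<^esub> A) = 1"
    "inv\<^bsub>SL ty n\<^esub> A * A = 1\<^sub>m n" "A * inv\<^bsub>SL ty n\<^esub> A = 1\<^sub>m n"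
    using inv_closed[OF A] l_inv[OF A] r_inv[OF A] by simp_all
qed

text \<open>\<open>Ad\<close> is written with \<open>TYPE('a)\<close>, whereas the statements carry
  a variable of type \<open>'a itself\<close>; this identifies the two resulting groups.\<close>

lemma SL_itself: "SL ty n = SL ty' n"
  by (simp add: SL_def)

lemma addrow_mat_SL:
  "i \<noteq> j \<Longrightarrow> addrow_mat n a i j \<in> carrier (SL ty n)"
  by (simp add: det_addrow_mat)

lemma SL_inv_addrow_mat:
  fixes a :: "'r::comm_ring_1"
  assumes "i < n" "j < n" "i \<noteq> j"
  shows "inv\<^bsub>SL ty n\<^esub> (addrow_mat n a i j) = addrow_mat n (- a) i j"
proof -
  interpret Group.group "SL ty n" by (rule SL_group)
  show ?thesis
    using addrow_mat_inv[OF assms, of "- a"] assms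
    by (intro inv_equality) (auto simp: det_addrow_mat)
qed

interpretation const_poly_hom: comm_ring_hom "\<lambda>a::'a::comm_ring_1. [:a:]"
  by unfold_locales auto

lemma const_mat_mult:
  "\<lbrakk>A \<in> carrier_mat n n; B \<in> carrier_mat n n\<rbrakk> \<Longrightarrow> const_mat (A * B) = const_mat A * const_mat B"
  unfolding const_mat_def by (rule const_poly_hom.mat_hom_mult)

lemma const_mat_carrier [simp]: "const_mat A \<in> carrier_mat n m \<longleftrightarrow> A \<in> carrier_mat n m"
  by (simp add: const_mat_def)

lemma const_mat_det: "det (const_mat A) = [:det A:]"
  unfolding const_mat_def by (rule const_poly_hom.hom_det)

lemma const_mat_addrow_mat: "const_mat (addrow_mat n a i j) = addrow_mat n [:a:] i j"
  by (intro eq_matI) (auto simp: const_mat_def poly_eq_iff coeff_pCons split: nat.split)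

interpretation eval0_hom: comm_ring_hom "\<lambda>p::'a::comm_ring_1 poly. poly p 0"
  by unfold_locales auto

lemma eval0_mult:
  "\<lbrakk>A \<in> carrier_mat n n; B \<in> carrier_mat n n\<rbrakk> \<Longrightarrow> eval0 (A * B) = eval0 A * eval0 B"
  unfolding eval0_def by (rule eval0_hom.mat_hom_mult)

lemma eval0_one: "eval0 (1\<^sub>m n) = 1\<^sub>m n"
  unfolding eval0_def by (rule eval0_hom.mat_hom_one)

lemma eval0_carrier [simp]: "eval0 A \<in> carrier_mat n m \<longleftrightarrow> A \<in> carrier_mat n m"
  by (simp add: eval0_def)

lemma eval0_det: "det (eval0 A) = poly (det A) 0"
  unfolding eval0_def by (rule eval0_hom.hom_det)

lemma eval0_const_mat: "eval0 (const_mat A) = A"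
  by (intro eq_matI) (auto simp: eval0_def const_mat_def)

lemma eval0_addrow_mat: "eval0 (addrow_mat n p i j) = addrow_mat n (poly p 0) i j"
  by (intro eq_matI) (auto simp: eval0_def)

lemma const_mat_hom: "const_mat \<in> hom (SL ty n) (SL ty' n)"
  by (auto simp: hom_def const_mat_mult const_mat_det)

lemma eval0_hom: "eval0 \<in> hom (SL ty n) (SL ty' n)"
  by (auto simp: hom_def eval0_mult eval0_det)

section \<open>The derivative at 0\<close>

definition deriv0 :: "'a::field poly mat \<Rightarrow> 'a mat" where
  "deriv0 = map_mat (\<lambda>p. coeff p 1)"

lemma deriv0_carrier [simp]: "deriv0 A \<in> carrier_mat n m \<longleftrightarrow> A \<in> carrier_mat n m"
  by (simp add: deriv0_def)

lemma deriv0_mult: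
  assumes "A \<in> carrier_mat n n" "B \<in> carrier_mat n n"
  shows "deriv0 (A * B) = deriv0 A * eval0 B + eval0 A * deriv0 B"
  using assms
  by (intro eq_matI)
    (auto simp: deriv0_def eval0_def scalar_prod_def coeff_sum coeff_mult poly_0_coeff_0
      sum.distrib algebra_simps)

lemma deriv0_const_mat: "A \<in> carrier_mat n n \<Longrightarrow> deriv0 (const_mat A) = 0\<^sub>m n n"
  by (intro eq_matI) (auto simp: deriv0_def const_mat_def)

lemma deriv0_addrow_mat:
  assumes "i < n" "j < n" "i \<noteq> j"
  shows "deriv0 (addrow_mat n p i j) = mat n n (\<lambda>kl. if kl = (i, j) then coeff p 1 else 0)"
  using assms by (intro eq_matI) (auto simp: deriv0_def)

section \<open>Trace zero matrices and the adjoint action\<close>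

lemma sum_diag_mult_commute:
  fixes A B :: "'a::comm_ring_1 mat"
  assumes "A \<in> carrier_mat n n" "B \<in> carrier_mat n n"
  shows "(\<Sum>i<n. (A * B) $$ (i, i)) = (\<Sum>i<n. (B * A) $$ (i, i))"
proof -
  have "(\<Sum>i<n. (A * B) $$ (i, i)) = (\<Sum>i<n. \<Sum>k<n. A $$ (i, k) * B $$ (k, i))"
    using assms by (intro sum.cong refl index_mult_mat_sum) auto
  also have "\<dots> = (\<Sum>k<n. \<Sum>i<n. B $$ (k, i) * A $$ (i, k))"
    by (subst sum.swap) (simp add: mult.commute)
  also have "\<dots> = (\<Sum>i<n. (B * A) $$ (i, i))"
    using assms by (intro sum.cong refl index_mult_mat_sum[symmetric]) auto
  finally show ?thesis .
qed

lemma sl_module_simps [simp]: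
  "X \<in> carrier (sl_module ty n) \<longleftrightarrow> X \<in> carrier_mat n n \<and> (\<Sum>i<n. X $$ (i, i)) = 0"
  "X \<oplus>\<^bsub>sl_module ty n\<^esub> Y = X + Y"
  "\<zero>\<^bsub>sl_module ty n\<^esub> = 0\<^sub>m n n"
  "a \<odot>\<^bsub>sl_module ty n\<^esub> X = a \<cdot>\<^sub>m X"
  by (auto simp: sl_module_def module_mat_simps)

lemma sl_module:
  fixes ty :: "'a::field itself"
  shows "Module.module class_ring (sl_module ty n)"
proof -
  have "module_mat ty n n = module_mat TYPE('a) n n" by (simp add: module_mat_def)
  then interpret M: vectorspace class_ring "module_mat ty n n" using matrix_vs by simp
  have "LinearCombinations.submodule class_ring (carrier (sl_module ty n)) (module_mat ty n n)"
    by (rule LinearCombinations.submodule.intro)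
      (auto simp: M.module_axioms sum.distrib sum_distrib_left[symmetric] module_mat_simps
        intro: M.module_axioms)
  then show ?thesis using M.submodule_is_module[of "carrier (sl_module ty n)"]
    by (simp add: sl_module_def)
qed

text \<open>The second claim expresses conjugation without an inverse, which is the form in which
  equivariance is evaluated on elementary matrices.\<close>

lemma Ad_carrier:
  assumes "g \<in> carrier (SL TYPE('a::field) n)" "X \<in> carrier_mat n n"
  shows "Ad n g X \<in> carrier_mat n n" "Ad n g X * g = g * X"
proof -
  have g: "g \<in> carrier_mat n n" "det g = 1" using assms by auto
  note i = SL_inv_carrier[OF g, of "TYPE('a)"]
  show "Ad n g X \<in> carrier_mat n n" using g i assms by (simp add: Ad_def)
  have "Ad n g X * g = g * X * (inv\<^bsub>SL TYPE('a) n\<^esub> g * g)"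
    using g i assms unfolding Ad_def by (intro assoc_mult_mat[of _ n n _ n _ n]) auto
  then show "Ad n g X * g = g * X" using g i assms by simp
qed

lemma sum_diag_Ad:
  fixes X :: "'a::field mat"
  assumes "g \<in> carrier (SL TYPE('a) n)" "X \<in> carrier_mat n n"
  shows "(\<Sum>i<n. Ad n g X $$ (i, i)) = (\<Sum>i<n. X $$ (i, i))"
proof -
  have g: "g \<in> carrier_mat n n" "det g = 1" using assms by auto
  note i = SL_inv_carrier[OF g, of "TYPE('a)"]
  have "(\<Sum>i<n. Ad n g X $$ (i, i)) = (\<Sum>i<n. (inv\<^bsub>SL TYPE('a) n\<^esub> g * (g * X)) $$ (i, i))"
    unfolding Ad_def using g i assms by (intro sum_diag_mult_commute) auto
  also have "inv\<^bsub>SL TYPE('a) n\<^esub> g * (g * X) = X"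
    using g i assms by (subst assoc_mult_mat[symmetric, of _ n n _ n _ n]) auto
  finally show ?thesis .
qed

lemma Ad_representation:
  fixes ty :: "'a::field itself"
  shows "linear_representation (SL ty n) class_ring (sl_module ty n) (Ad n)"
proof -
  interpret G: Group.group "SL ty n" by (rule SL_group)
  interpret M: Module.module class_ring "sl_module ty n" by (rule sl_module)
  have ty: "SL TYPE('a) n = SL ty n" by (rule SL_itself)
  show ?thesis
  proof unfold_locales
    fix g X assume g: "g \<in> carrier (SL ty n)" and X: "X \<in> carrier (sl_module ty n)"
    have g': "g \<in> carrier_mat n n" "det g = 1" using g by auto
    note i = SL_inv_carrier[OF g', of "TYPE('a)"]
    have X': "X \<in> carrier_mat n n" using X by simp
    show "Ad n g X \<in> carrier (sl_module ty n)"
      using X g Ad_carrier(1)[of g n X] sum_diag_Ad[of g n X] by simp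
    show "Ad n g (a \<odot>\<^bsub>sl_module ty n\<^esub> X) = a \<odot>\<^bsub>sl_module ty n\<^esub> Ad n g X" for a
      using X' g' i by (simp add: Ad_def mult_smult_distrib[of _ n n _ n] mult_smult_assoc_mat[of _ n n _ n])
    fix Y assume "Y \<in> carrier (sl_module ty n)"
    then have "Y \<in> carrier_mat n n" by simp
    then show "Ad n g (X \<oplus>\<^bsub>sl_module ty n\<^esub> Y) = Ad n g X \<oplus>\<^bsub>sl_module ty n\<^esub> Ad n g Y"
      using X' g' i by (simp add: Ad_def mult_add_distrib_mat[of _ n n _ n] add_mult_distrib_mat[of _ n n _ _ n])
  next
    fix g h X assume gh: "g \<in> carrier (SL ty n)" "h \<in> carrier (SL ty n)" and "X \<in> carrier (sl_module ty n)"
    then have X: "X \<in> carrier_mat n n" by simp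
    have inv: "inv\<^bsub>SL TYPE('a) n\<^esub> (g * h) = inv\<^bsub>SL TYPE('a) n\<^esub> h * inv\<^bsub>SL TYPE('a) n\<^esub> g"
      using G.inv_mult_group[OF gh] by (simp add: ty)
    have c: "g \<in> carrier_mat n n" "h \<in> carrier_mat n n"
      "inv\<^bsub>SL TYPE('a) n\<^esub> g \<in> carrier_mat n n" "inv\<^bsub>SL TYPE('a) n\<^esub> h \<in> carrier_mat n n"
      using gh SL_inv_carrier(1) by auto
    show "Ad n (g \<otimes>\<^bsub>SL ty n\<^esub> h) X = Ad n g (Ad n h X)"
      using c X unfolding Ad_def SL_simps inv
      by (simp add: assoc_mult_mat[of _ n n _ n _ n] mult_carrier_mat[of _ n n _ n])
  next
    fix X assume "X \<in> carrier (sl_module ty n)"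
    then have "X \<in> carrier_mat n n" by simp
    then show "Ad n \<one>\<^bsub>SL ty n\<^esub> X = X"
      using G.inv_one unfolding Ad_def ty by auto
  qed
qed

text \<open>Along \<open>eval0\<close> this turns the adjoint representation of SL_n(F) into a
  representation of SL_n(F[t]).\<close>

lemma (in linear_representation) pullback:
  assumes "Group.group H" "\<phi> \<in> hom H G"
  shows "linear_representation H R V (\<lambda>h. \<rho> (\<phi> h))"
proof -
  interpret H: Group.group H by fact
  interpret group_hom H G \<phi> using assms(2) by unfold_locales
  show ?thesis
    by unfold_locales
      (auto simp: action_closed action_add action_smult action_mult action_one)
qed

section \<open>Equivariant homomorphisms on the upper triangular congruence group\<close>

lemma X_dvd_iff:
  fixes p :: "'a::field poly"
  shows "[:0, 1:] dvd p \<longleftrightarrow> poly p 0 = 0" "pCons 0 1 dvd p \<longleftrightarrow> poly p 0 = 0"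
  using poly_eq_0_iff_dvd[of p 0] by simp_all

lemma carrier_Borel: "A \<in> carrier (Borel ty n) \<longleftrightarrow> A \<in> carrier (SL ty n) \<and> upper_triangular A"
  by (simp add: Borel_def)

lemma prod_diag_upper_triangular:
  assumes "A \<in> carrier_mat n n" "upper_triangular A"
  shows "det A = (\<Prod>i<n. A $$ (i, i))"
  using det_upper_triangular[OF assms(2,1)] assms(1)
  by (simp add: prod_list_diag_prod atLeast0LessThan)

text \<open>A diagonal entry divides the determinant 1, so it is a unit of F[t], hence a constant,
  and the congruence modulo t makes this constant 1. Conversely a unitriangular matrix has
  determinant 1.\<close>

lemma carrier_upper_congruence_group:
  fixes ty :: "'a::field itself"
  shows "A \<in> carrier (upper_congruence_group ty n) \<longleftrightarrow> unitriangular_mod [:0, 1:] n A"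
proof
  assume *: "A \<in> carrier (upper_congruence_group ty n)"
  then have A: "A \<in> carrier_mat n n" "upper_triangular A" "det A = 1"
    and dvd: "\<And>i j. \<lbrakk>i < n; j < n\<rbrakk> \<Longrightarrow> [:0, 1:] dvd A $$ (i, j) - (if i = j then 1 else 0)"
    by (auto simp: upper_congruence_group_def congruence_subgroup_def)
  have "A $$ (i, i) = 1" if i: "i < n" for i
  proof -
    have "A $$ (i, i) dvd det A"
      unfolding prod_diag_upper_triangular[OF A(1,2)] using i by (intro dvd_prodI) auto
    then have "A $$ (i, i) dvd 1" using A by simp
    then obtain c where c: "A $$ (i, i) = [:c:]" by (auto simp: is_unit_poly_iff)
    have "poly (A $$ (i, i) - 1) 0 = 0" using dvd[OF i i] by (simp add: X_dvd_iff)
    then show ?thesis using c by simp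
  qed
  moreover have "[:0, 1:] dvd A $$ (i, j)" if "i < j" "j < n" for i j
    using dvd[of i j] that by simp
  ultimately show "unitriangular_mod [:0, 1:] n A"
    using A by (auto simp: unitriangular_mod_def upper_triangular_def)
next
  assume A: "unitriangular_mod [:0, 1:] n A"
  then have "A \<in> carrier_mat n n" "upper_triangular A"
    by (auto simp: unitriangular_mod_def intro!: upper_triangularI)
  moreover from this have "det A = 1"
    using A by (simp add: prod_diag_upper_triangular unitriangular_mod_def)
  moreover have "[:0, 1:] dvd A $$ (i, j) - 1\<^sub>m n $$ (i, j)" if "i < n" "j < n" for i j
    using A that by (cases i j rule: linorder_cases) (auto simp: unitriangular_mod_def)
  ultimately show "A \<in> carrier (upper_congruence_group ty n)"
    by (simp add: upper_congruence_group_def congruence_subgroup_def)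
qed

lemma addrow_mat_upper_congruence:
  "\<lbrakk>i < j; j < n; [:0, 1:] dvd p\<rbrakk> \<Longrightarrow> addrow_mat n p i j \<in> carrier (upper_congruence_group ty n)"
  unfolding carrier_upper_congruence_group by (auto simp: unitriangular_mod_def)

lemma addrow_mat_Borel:
  "\<lbrakk>i < j; j < n\<rbrakk> \<Longrightarrow> addrow_mat n a i j \<in> carrier (Borel ty n)"
  unfolding carrier_Borel by (auto simp: det_addrow_mat intro!: upper_triangularI)

lemma eval0_upper_congruence:
  fixes ty :: "'a::field itself"
  shows "A \<in> carrier (upper_congruence_group ty n) \<Longrightarrow> eval0 A = 1\<^sub>m n"
proof (rule eq_matI)
  assume "A \<in> carrier (upper_congruence_group ty n)"
  then have A: "unitriangular_mod [:0, 1:] n A" by (simp only: carrier_upper_congruence_group)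
  fix i j assume "i < dim_row (1\<^sub>m n :: 'a mat)" "j < dim_col (1\<^sub>m n :: 'a mat)"
  then have ij: "i < n" "j < n" by simp_all
  then have "A \<in> carrier_mat n n"
    "if i < j then [:0, 1:] dvd A $$ (i, j) else A $$ (i, j) = (if i = j then 1 else 0)"
    using A unfolding unitriangular_mod_def by blast+
  then show "eval0 A $$ (i, j) = 1\<^sub>m n $$ (i, j)"
    using ij by (auto simp: eval0_def X_dvd_iff split: if_splits)
qed (auto simp: carrier_upper_congruence_group unitriangular_mod_def eval0_def)

lemma unitriangular_mod_mult:
  fixes A B :: "'r::comm_ring_1 mat"
  assumes A: "unitriangular_mod x n A" and B: "unitriangular_mod x n B"
  shows "unitriangular_mod x n (A * B)"
proof -
  have c: "A \<in> carrier_mat n n" "B \<in> carrier_mat n n"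
    using A B by (auto simp: unitriangular_mod_def)
  have entry: "(A * B) $$ (i, j) = (\<Sum>k<n. A $$ (i, k) * B $$ (k, j))" if "i < n" "j < n" for i j
    using c that by (intro index_mult_mat_sum) auto
  have lower: "A $$ (i, k) * B $$ (k, j) = 0" if "i < n" "j < n" "k < n" "j < i" for i j k
    using A B that by (cases "k < i") (auto simp: unitriangular_mod_def)
  have diag: "A $$ (i, k) * B $$ (k, i) = (if k = i then 1 else 0)" if "i < n" "k < n" for i k
    using A B that by (cases k i rule: linorder_cases) (auto simp: unitriangular_mod_def)
  have upper: "x dvd A $$ (i, k) * B $$ (k, j)" if "i < n" "j < n" "k < n" "i < j" for i j k
    using A B that by (cases "i < k") (auto simp: unitriangular_mod_def)
  show ?thesis
    unfolding unitriangular_mod_def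
  proof (intro conjI allI impI)
    fix i j assume ij: "i < n" "j < n"
    show "if i < j then x dvd (A * B) $$ (i, j) else (A * B) $$ (i, j) = (if i = j then 1 else 0)"
      unfolding entry[OF ij]
      using ij lower[OF ij] diag[OF ij(1)] upper[OF ij]
      by (cases i j rule: linorder_cases) (auto intro: dvd_sum)
  qed (use c in auto)
qed

text \<open>If \<open>C\<close> is a left inverse of E B with E elementary, then C E is one of
  \<open>B\<close>, and all factors stay unitriangular modulo \<open>x\<close>. A left inverse is
  enough for the later use inside the group SL_n(F[t]).\<close>

lemma unitriangular_mod_inverse:
  fixes A :: "'r::comm_ring_1 mat"
  assumes "unitriangular_mod x n A"
  shows "\<exists>B. unitriangular_mod x n B \<and> B * A = 1\<^sub>m n"
proof (rule unitriangular_elementary_induct[OF assms])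
  have "unitriangular_mod x n (1\<^sub>m n)" by (auto simp: unitriangular_mod_def)
  then show "\<exists>B. unitriangular_mod x n B \<and> B * 1\<^sub>m n = 1\<^sub>m n"
    by (intro exI[of _ "1\<^sub>m n"]) auto
next
  fix B a i j
  assume B: "unitriangular_mod x n B" "i < j" "j < n" "x dvd a"
    and "\<exists>C. unitriangular_mod x n C \<and> C * addrow a i j B = 1\<^sub>m n"
  then obtain C where C: "unitriangular_mod x n C" "C * addrow a i j B = 1\<^sub>m n" by blast
  have E: "unitriangular_mod x n (addrow_mat n a i j)"
    using B by (auto simp: unitriangular_mod_def)
  have Bc: "B \<in> carrier_mat n n" "C \<in> carrier_mat n n"
    using B C by (auto simp: unitriangular_mod_def)
  have "C * addrow_mat n a i j * B = 1\<^sub>m n"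
    using C(2) Bc addrow_mat[OF Bc(1) B(3)] by (simp add: assoc_mult_mat[of _ n n _ n _ n])
  then show "\<exists>C. unitriangular_mod x n C \<and> C * B = 1\<^sub>m n"
    using unitriangular_mod_mult[OF C(1) E] by blast
qed

lemma upper_congruence_group_subgroup:
  fixes ty :: "'a::field itself"
  shows "subgroup (carrier (upper_congruence_group ty n)) (SL TYPE('a poly) n)"
proof -
  interpret Group.group "SL TYPE('a poly) n" by (rule SL_group)
  have sub: "A \<in> carrier (SL TYPE('a poly) n)" if "A \<in> carrier (upper_congruence_group ty n)" for A
    using that by (simp add: upper_congruence_group_def congruence_subgroup_def)
  show ?thesis
  proof (rule subgroupI)
    have "1\<^sub>m n \<in> carrier (upper_congruence_group ty n)"
      unfolding carrier_upper_congruence_group by (auto simp: unitriangular_mod_def)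
    then show "carrier (upper_congruence_group ty n) \<noteq> {}" by blast
  next
    fix A assume A: "A \<in> carrier (upper_congruence_group ty n)"
    then obtain B where B: "B \<in> carrier (upper_congruence_group ty n)" "B * A = 1\<^sub>m n"
      using unitriangular_mod_inverse carrier_upper_congruence_group by blast
    have "inv\<^bsub>SL TYPE('a poly) n\<^esub> A = B"
      using sub[OF A] sub[OF B(1)] B(2) by (intro inv_equality) auto
    then show "inv\<^bsub>SL TYPE('a poly) n\<^esub> A \<in> carrier (upper_congruence_group ty n)" using B by simp
  next
    fix A B assume "A \<in> carrier (upper_congruence_group ty n)" "B \<in> carrier (upper_congruence_group ty n)"
    then show "A \<otimes>\<^bsub>SL TYPE('a poly) n\<^esub> B \<in> carrier (upper_congruence_group ty n)"
      using unitriangular_mod_mult by (simp add: carrier_upper_congruence_group)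
  qed (use sub in blast)
qed

text \<open>Here \<open>\<psi>\<close> lives on the matrices of C and not on cosets of [C, C].
  Equivariance is required for pairs \<open>A\<close>, \<open>A'\<close> with b A = A' b, because
  the Steinberg relations deliver such pairs directly and no conjugate has to be computed.\<close>

context
  fixes n :: nat and \<psi> :: "'a::field_char_0 poly mat \<Rightarrow> 'a mat"
  assumes n: "n \<ge> 3"
    and closed: "\<And>A. unitriangular_mod [:0, 1:] n A \<Longrightarrow> \<psi> A \<in> carrier_mat n n"
    and mult: "\<And>A B. \<lbrakk>unitriangular_mod [:0, 1:] n A; unitriangular_mod [:0, 1:] n B\<rbrakk>
      \<Longrightarrow> \<psi> (A * B) = \<psi> A + \<psi> B"
    and equivariant: "\<And>b A A'. \<lbrakk>b \<in> carrier (Borel TYPE('a) n);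
        unitriangular_mod [:0, 1:] n A; unitriangular_mod [:0, 1:] n A';
        const_mat b * A = A' * const_mat b\<rbrakk> \<Longrightarrow> \<psi> A' * b = b * \<psi> A"
begin

lemma elementary_unitriangular:
  "\<lbrakk>i < j; j < n; [:0, 1:] dvd p\<rbrakk> \<Longrightarrow> unitriangular_mod [:0, 1:] n (addrow_mat n p i j)"
  by (auto simp: unitriangular_mod_def)

lemma \<psi>_elementary_add:
  assumes "i < j" "j < n" "[:0, 1:] dvd p" "[:0, 1:] dvd q"
  shows "\<psi> (addrow_mat n (p + q) i j) = \<psi> (addrow_mat n p i j) + \<psi> (addrow_mat n q i j)"
  using mult[OF elementary_unitriangular[OF assms(1,2,3)] elementary_unitriangular[OF assms(1,2,4)]]
    assms by (simp add: addrow_mat_add)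

lemma \<psi>_one: "\<psi> (1\<^sub>m n) = 0\<^sub>m n n"
proof -
  have 1: "unitriangular_mod [:0, 1:] n (1\<^sub>m n :: 'a poly mat)" by (auto simp: unitriangular_mod_def)
  have "\<psi> (1\<^sub>m n) = \<psi> (1\<^sub>m n) + \<psi> (1\<^sub>m n)" using mult[OF 1 1] by simp
  then have "\<psi> (1\<^sub>m n) $$ (i, j) = \<psi> (1\<^sub>m n) $$ (i, j) + \<psi> (1\<^sub>m n) $$ (i, j)"
    if "i < n" "j < n" for i j
    using closed[OF 1] that by (metis carrier_matD index_add_mat(1))
  then show ?thesis using closed[OF 1] by (intro eq_matI) auto
qed

lemma \<psi>_elementary_entry:
  assumes "i < j" "j < n" "[:0, 1:] dvd p" "k < n" "l < n" "(k, l) \<noteq> (i, j)"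
  shows "\<psi> (addrow_mat n p i j) $$ (k, l) = 0"
proof -
  \<comment> \<open>The root \<open>(i, j)\<close> takes the value \<open>4\<close> on this torus element, and no other \<open>d k / d l\<close> is \<open>4\<close>.\<close>
  define d :: "nat \<Rightarrow> 'a" where "d m = (if m = i then 2 else if m = j then 1 / 2 else 1)" for m
  define D where "D = mat_diag n d"
  define X where "X = \<psi> (addrow_mat n p i j)"
  have ij: "unitriangular_mod [:0, 1:] n (addrow_mat n q i j)" if "[:0, 1:] dvd q" for q
    using assms(1,2) that by (rule elementary_unitriangular)
  have X: "X \<in> carrier_mat n n" using closed[OF ij[OF assms(3)]] by (simp add: X_def)
  have D: "D \<in> carrier_mat n n" by (simp add: D_def)
  have upper: "upper_triangular D" by (auto simp: D_def mat_diag_def intro!: upper_triangularI)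
  have "det D = (\<Prod>m<n. d m)"
    unfolding prod_diag_upper_triangular[OF D upper] by (simp add: D_def mat_diag_def)
  also have "\<dots> = d i * (d j * (\<Prod>m\<in>{..<n} - {i} - {j}. d m))"
    using assms by (subst prod.remove[of _ i], simp, simp, subst prod.remove[of _ j]) auto
  also have "\<dots> = 1" using assms by (auto simp: d_def intro!: prod.neutral)
  finally have B: "D \<in> carrier (Borel TYPE('a) n)"
    using D upper by (simp add: carrier_Borel)
  define p4 where "p4 = Polynomial.smult 4 p"
  have p2: "[:0, 1:] dvd p + p" using assms(3) by (rule dvd_add) (rule assms(3))
  have p4: "[:0, 1:] dvd p4" unfolding p4_def using assms(3) by (rule dvd_smult)
  \<comment> \<open>Additivity of \<open>\<psi>\<close> applies to this sum; it could not be applied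
    to a general scalar multiple of \<open>p\<close>.\<close>
  have p4_eq: "p4 = (p + p) + (p + p)" 
    unfolding p4_def by (rule poly_eqI, simp only: coeff_smult coeff_add, simp)
  have "const_mat D * addrow_mat n p i j = addrow_mat n p4 i j * const_mat D"
  proof -
    have "addrow_mat n p4 i j * const_mat D = addrow p4 i j (const_mat D)"
      using assms D by (intro addrow_mat[symmetric]) auto
    moreover have "const_mat D * addrow_mat n p i j = mat n n (\<lambda>(k, l). [:d k:] * addrow_mat n p i j $$ (k, l))"
    proof -
      have "const_mat D = mat_diag n (\<lambda>k. [:d k:])"
        by (intro eq_matI) (auto simp: D_def const_mat_def mat_diag_def)
      then show ?thesis by (simp add: mat_diag_mult_left[of _ n n])
    qed
    moreover have "[:2:] * p = p4 * [:1 / 2:]"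
      by (simp add: p4_def)
    ultimately show ?thesis
      using assms D by (intro eq_matI) (auto simp: const_mat_def D_def mat_diag_def d_def)
  qed
  from equivariant[OF B ij[OF assms(3)] ij[OF p4] this]
  have "\<psi> (addrow_mat n p4 i j) * D = D * X" by (simp add: X_def)
  moreover have "\<psi> (addrow_mat n p4 i j) = (X + X) + (X + X)"
    unfolding p4_eq \<psi>_elementary_add[OF assms(1,2) p2 p2]
      \<psi>_elementary_add[OF assms(1,2,3,3)] X_def ..
  ultimately have "((X + X) + (X + X)) * D = D * X" by simp
  then have "(((X + X) + (X + X)) * D) $$ (k, l) = (D * X) $$ (k, l)" by simp
  then have "4 * X $$ (k, l) * d l = d k * X $$ (k, l)"
    using X assms by (simp add: D_def mat_diag_mult_left[of _ n n] mat_diag_mult_right[of _ n n])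
  \<comment> \<open>Off the root the ratio \<open>d k / d l\<close> is 1, 2, 1/2 or 1/4, and none of
    these equals 4 in characteristic zero.\<close>
  moreover have "4 * d l \<noteq> d k" using assms by (auto simp: d_def)
  ultimately show ?thesis by (simp add: X_def mult.commute)
qed

text \<open>The scalar s(p) of the overview, which at this point may still depend on the
  root.\<close>

definition root_coeff :: "nat \<Rightarrow> nat \<Rightarrow> 'a poly \<Rightarrow> 'a" where
  "root_coeff i j p = \<psi> (addrow_mat n p i j) $$ (i, j)"

lemma \<psi>_elementary:
  assumes "i < j" "j < n" "[:0, 1:] dvd p"
  shows "\<psi> (addrow_mat n p i j) = mat n n (\<lambda>kl. if kl = (i, j) then root_coeff i j p else 0)"
  using closed[OF elementary_unitriangular[OF assms]] \<psi>_elementary_entry[OF assms]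
  by (intro eq_matI) (auto simp: root_coeff_def)

lemma root_coeff_add:
  assumes "i < j" "j < n" "[:0, 1:] dvd p" "[:0, 1:] dvd q"
  shows "root_coeff i j (p + q) = root_coeff i j p + root_coeff i j q"
  using assms closed[OF elementary_unitriangular[OF assms(1,2,4)]]
  by (simp add: root_coeff_def \<psi>_elementary_add)

lemma root_coeff_minus:
  assumes "i < j" "j < n" "[:0, 1:] dvd p"
  shows "root_coeff i j (- p) = - root_coeff i j p"
proof -
  have "root_coeff i j 0 = 0"
    using assms by (simp add: root_coeff_def addrow_mat_zero \<psi>_one)
  then show ?thesis using root_coeff_add[of i j p "- p"] assms
    by (simp add: eq_neg_iff_add_eq_0 add.commute)
qed

text \<open>Conjugating e_ij(p) by the constant e_jk(x) adds the factor e_ik(- p x). In position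
  \<open>(i, k)\<close> of the equivariance equation one sees the coefficient of this factor, and x
  times the coefficient of e_ij(p) contributed by the column operation; the other side is 0 there.
  So x comes out although \<open>\<psi>\<close> is only known to be additive.\<close>

lemma root_coeff_right:
  assumes "i < j" "j < k" "k < n" "[:0, 1:] dvd p"
  shows "root_coeff i k (p * [:x:]) = x * root_coeff i j p"
proof -
  let ?E = "addrow_mat n p i j" and ?b = "addrow_mat n x j k"
  let ?F = "addrow_mat n (- (p * [:x:])) i k"
  have b: "?b \<in> carrier (Borel TYPE('a) n)" using assms by (intro addrow_mat_Borel) auto
  have dvd: "[:0, 1:] dvd - (p * [:x:])" using assms(4) by (metis dvd_minus_iff dvd_mult2)
  have E: "unitriangular_mod [:0, 1:] n ?E"
    by (rule elementary_unitriangular) (use assms in simp_all)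
  have F: "unitriangular_mod [:0, 1:] n ?F"
    by (rule elementary_unitriangular) (use assms dvd in simp_all)
  have FE: "unitriangular_mod [:0, 1:] n (?F * ?E)"
    using F E by (rule unitriangular_mod_mult)
  have "const_mat ?b * ?E = ?F * ?E * const_mat ?b"
    unfolding const_mat_addrow_mat using assms by (intro addrow_mat_commutator') auto
  from equivariant[OF b E FE this]
  have "(\<psi> ?F + \<psi> ?E) * ?b = ?b * \<psi> ?E" using mult[OF F E] by simp
  moreover have "?b * \<psi> ?E = addrow x j k (\<psi> ?E)"
    using assms closed[OF E] by (intro addrow_mat[symmetric]) auto
  moreover have "(\<psi> ?F + \<psi> ?E) * ?b = addcol x k j (\<psi> ?F + \<psi> ?E)"
    using assms closed[OF E] closed[OF F] by (intro addcol_mat[symmetric]) auto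
  ultimately have "addcol x k j (\<psi> ?F + \<psi> ?E) $$ (i, k) = addrow x j k (\<psi> ?E) $$ (i, k)" by simp
  then have "x * root_coeff i j p + root_coeff i k (- (p * [:x:])) = 0"
    using assms dvd by (simp add: \<psi>_elementary mat_addcol_def)
  then show ?thesis
    using root_coeff_minus[OF less_trans[OF assms(1,2)] assms(3) dvd_mult2[OF assms(4)], of "[:x:]"]
    by simp
qed

text \<open>The mirror image of \<open>root_coeff_right\<close>: the constant e_ki(x) now
  contributes the factor x through a row operation, on the other side of the equation.\<close>

lemma root_coeff_left:
  assumes "k < i" "i < j" "j < n" "[:0, 1:] dvd p"
  shows "root_coeff k j ([:x:] * p) = x * root_coeff i j p"
proof -
  let ?E = "addrow_mat n p i j" and ?b = "addrow_mat n x k i"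
  let ?F = "addrow_mat n ([:x:] * p) k j"
  have b: "?b \<in> carrier (Borel TYPE('a) n)" using assms by (intro addrow_mat_Borel) auto
  have dvd: "[:0, 1:] dvd [:x:] * p" using assms(4) by (rule dvd_mult)
  have E: "unitriangular_mod [:0, 1:] n ?E"
    by (rule elementary_unitriangular) (use assms in simp_all)
  have F: "unitriangular_mod [:0, 1:] n ?F"
    by (rule elementary_unitriangular) (use assms dvd in simp_all)
  have FE: "unitriangular_mod [:0, 1:] n (?F * ?E)"
    using F E by (rule unitriangular_mod_mult)
  have "const_mat ?b * ?E = ?F * (?E * const_mat ?b)"
    unfolding const_mat_addrow_mat using assms by (intro addrow_mat_commutator) auto
  then have "const_mat ?b * ?E = ?F * ?E * const_mat ?b"
    by (simp add: assoc_mult_mat[of _ n n _ n _ n])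
  from equivariant[OF b E FE this]
  have "(\<psi> ?F + \<psi> ?E) * ?b = ?b * \<psi> ?E" using mult[OF F E] by simp
  moreover have "?b * \<psi> ?E = addrow x k i (\<psi> ?E)"
    using assms closed[OF E] by (intro addrow_mat[symmetric]) auto
  moreover have "(\<psi> ?F + \<psi> ?E) * ?b = addcol x i k (\<psi> ?F + \<psi> ?E)"
    using assms closed[OF E] closed[OF F] by (intro addcol_mat[symmetric]) auto
  ultimately have "addcol x i k (\<psi> ?F + \<psi> ?E) $$ (k, j) = addrow x k i (\<psi> ?E) $$ (k, j)" by simp
  then show ?thesis
    using assms dvd by (simp add: \<psi>_elementary mat_addcol_def)
qed

text \<open>With x = 1 the two transport rules move any root to the corner
  \<open>(0, n - 1)\<close>: first the column index goes to \<open>n - 1\<close>, then the row index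
  to 0.\<close>

lemma root_coeff_eq:
  assumes "i < j" "j < n" "[:0, 1:] dvd p"
  shows "root_coeff i j p = root_coeff 0 (n - 1) p"
proof -
  have "root_coeff i j p = root_coeff i (n - 1) p"
    using root_coeff_right[of i j "n - 1" p 1] assms by (cases "j = n - 1") auto
  also have "\<dots> = root_coeff 0 (n - 1) p"
    using root_coeff_left[of 0 i "n - 1" p 1] assms by (cases "i = 0") auto
  finally show ?thesis .
qed

text \<open>The scalar is released on the way from the root \<open>(0, 1)\<close> to the corner, a
  genuine step because \<open>1 < n - 1\<close>; independence of the root then returns the
  coefficient to the corner.\<close>

lemma root_coeff_scale:
  assumes "[:0, 1:] dvd p"
  shows "root_coeff 0 (n - 1) (p * [:x:]) = x * root_coeff 0 (n - 1) p"
  using root_coeff_right[of 0 1 "n - 1" p x] root_coeff_eq[of 0 1 p] assms n by simp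

text \<open>Both factors e_01(p) and e_1,n-1(q) lie in C, so their commutator e_0,n-1(p q) has image
  zero in the abelian target.\<close>

lemma root_coeff_square:
  assumes "[:0, 1:] dvd p" "[:0, 1:] dvd q"
  shows "root_coeff 0 (n - 1) (p * q) = 0"
proof -
  let ?E = "addrow_mat n p 0 1" and ?F = "addrow_mat n q 1 (n - 1)"
  let ?G = "addrow_mat n (p * q) 0 (n - 1)"
  have E: "unitriangular_mod [:0, 1:] n ?E"
    by (rule elementary_unitriangular) (use assms n in simp_all)
  have F: "unitriangular_mod [:0, 1:] n ?F"
    by (rule elementary_unitriangular) (use assms n in simp_all)
  have G: "unitriangular_mod [:0, 1:] n ?G"
    by (rule elementary_unitriangular) (use assms n in \<open>simp_all add: dvd_mult2\<close>)
  have FE: "unitriangular_mod [:0, 1:] n (?F * ?E)"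
    using F E by (rule unitriangular_mod_mult)
  have "?E * ?F = ?G * (?F * ?E)"
    using n by (intro addrow_mat_commutator) auto
  then have "\<psi> ?E + \<psi> ?F = \<psi> ?G + (\<psi> ?F + \<psi> ?E)"
    using mult[OF E F] mult[OF G FE] mult[OF F E] by simp
  then have "(\<psi> ?E + \<psi> ?F) $$ (0, n - 1) = (\<psi> ?G + (\<psi> ?F + \<psi> ?E)) $$ (0, n - 1)" by simp
  then show ?thesis using closed[OF E] closed[OF F] closed[OF G] n
    by (simp add: root_coeff_def)
qed

text \<open>Write p = c t + t (t r). The first summand is a scalar multiple of t, and the second is
  a product of two multiples of t, on which the coefficient vanishes.\<close>

lemma root_coeff_value:
  assumes "i < j" "j < n" "[:0, 1:] dvd p"
  shows "root_coeff i j p = coeff p 1 * root_coeff 0 (n - 1) [:0, 1:]"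
proof -
  obtain q where q: "p = [:0, 1:] * q" using assms(3) by (elim dvdE)
  obtain c r where r: "q = pCons c r" by (rule pCons_cases)
  have "q = [:c:] + [:0, 1:] * r" using r by simp
  then have p: "p = [:0, 1:] * [:c:] + [:0, 1:] * ([:0, 1:] * r)"
    unfolding q by (simp only: distrib_left)
  have "root_coeff 0 (n - 1) p = root_coeff 0 (n - 1) ([:0, 1:] * [:c:])
      + root_coeff 0 (n - 1) ([:0, 1:] * ([:0, 1:] * r))"
    unfolding p using n by (intro root_coeff_add dvd_triv_left) auto
  also have "\<dots> = c * root_coeff 0 (n - 1) [:0, 1:]"
    unfolding root_coeff_scale[OF dvd_refl] root_coeff_square[OF dvd_refl dvd_triv_left] by simp
  also have "c = coeff p 1" using q r by simp
  finally show ?thesis using root_coeff_eq[OF assms] by simp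
qed

text \<open>Both sides are additive on C, the right one by the product rule and because matrices of
  C are 1 at t = 0. Hence agreement on elementary matrices suffices, and the induction from E B to B
  cancels the contribution of E.\<close>

lemma \<psi>_eq_deriv0:
  assumes "unitriangular_mod [:0, 1:] n A"
  shows "\<psi> A = root_coeff 0 (n - 1) [:0, 1:] \<cdot>\<^sub>m deriv0 A"
proof (rule unitriangular_elementary_induct[OF assms])
  show "\<psi> (1\<^sub>m n) = root_coeff 0 (n - 1) [:0, 1:] \<cdot>\<^sub>m deriv0 (1\<^sub>m n)"
    unfolding \<psi>_one by (intro eq_matI) (auto simp: deriv0_def)
next
  fix B :: "'a poly mat" and a :: "'a poly" and i j :: nat
  let ?c = "root_coeff 0 (n - 1) [:0, 1:]"
  assume B: "unitriangular_mod [:0, 1:] n B" and ij: "i < j" "j < n" "[:0, 1:] dvd a"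
    and IH: "\<psi> (addrow a i j B) = ?c \<cdot>\<^sub>m deriv0 (addrow a i j B)"
  let ?E = "addrow_mat n a i j"
  have Bc: "B \<in> carrier_mat n n" using B by (simp add: unitriangular_mod_def)
  have E: "unitriangular_mod [:0, 1:] n ?E" using ij by (rule elementary_unitriangular)
  have eq: "addrow a i j B = ?E * B" using Bc ij by (intro addrow_mat) auto
  have 1: "eval0 ?E = 1\<^sub>m n" "eval0 B = 1\<^sub>m n"
    using E B carrier_upper_congruence_group eval0_upper_congruence by blast+
  have "deriv0 (?E * B) = deriv0 ?E + deriv0 B"
    using deriv0_mult[OF addrow_mat_carrier Bc, of a i j] Bc
      right_mult_one_mat[of "deriv0 ?E" n n] left_mult_one_mat[of "deriv0 B" n n]
    unfolding 1 by simp
  moreover have "\<psi> ?E = ?c \<cdot>\<^sub>m deriv0 ?E"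
    unfolding \<psi>_elementary[OF ij] root_coeff_value[OF ij]
    using ij by (intro eq_matI) (auto simp: deriv0_addrow_mat)
  ultimately have *: "?c \<cdot>\<^sub>m deriv0 ?E + \<psi> B = ?c \<cdot>\<^sub>m (deriv0 ?E + deriv0 B)"
    using IH mult[OF E B] unfolding eq by simp
  show "\<psi> B = ?c \<cdot>\<^sub>m deriv0 B"
  proof (rule eq_matI)
    fix k l assume kl: "k < dim_row (?c \<cdot>\<^sub>m deriv0 B)" "l < dim_col (?c \<cdot>\<^sub>m deriv0 B)"
    have "(?c \<cdot>\<^sub>m deriv0 ?E + \<psi> B) $$ (k, l) = (?c \<cdot>\<^sub>m (deriv0 ?E + deriv0 B)) $$ (k, l)"
      using * by simp
    then show "\<psi> B $$ (k, l) = (?c \<cdot>\<^sub>m deriv0 B) $$ (k, l)"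
      using kl Bc closed[OF B] by (simp add: deriv0_def algebra_simps)
  qed (use Bc closed[OF B] in \<open>auto simp: deriv0_def\<close>)
qed

end

section \<open>Abelianization and conjugation\<close>

lemma (in Group.group) derived_normal: "derived G (carrier G) \<lhd> G"
  by (intro derived_is_normal normal_invI subgroup_self) auto

lemma carrier_abelianization:
  "carrier (abelianization G) = (\<lambda>x. derived G (carrier G) #>\<^bsub>G\<^esub> x) ` carrier G"
  by (simp add: abelianization_def carrier_FactGroup)

lemma (in Group.group) abelianization_mult:
  assumes "x \<in> carrier G" "y \<in> carrier G"
  shows "(derived G (carrier G) #> x) \<otimes>\<^bsub>abelianization G\<^esub> (derived G (carrier G) #> y)
    = derived G (carrier G) #> (x \<otimes> y)"
  using normal.rcos_sum[OF derived_normal assms] by (simp add: abelianization_def)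

lemma (in Group.group) abelianization_coset_carrier:
  assumes "x \<in> carrier G" "y \<in> derived G (carrier G) #> x"
  shows "y \<in> carrier G"
  using assms r_coset_subset_G[OF derived_in_carrier[OF subset_refl]] by blast

text \<open>The derived subgroup is mapped onto the derived subgroup of the image, which is trivial
  in an abelian group. This makes values at arbitrarily chosen coset representatives well
  defined.\<close>

lemma (in Group.group) hom_abelianization_coset:
  assumes "comm_group A" "\<psi> \<in> hom G A" "x \<in> carrier G" "y \<in> derived G (carrier G) #> x"
  shows "\<psi> y = \<psi> x"
proof -
  interpret A: comm_group A by fact
  interpret group_hom G A \<psi> using assms(2) by unfold_locales
  obtain d where d: "d \<in> derived G (carrier G)" "y = d \<otimes> x"
    using assms(4) by (auto simp: r_coset_def)
  have "\<psi> ` derived G (carrier G) = derived A (\<psi> ` carrier G)"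
    by (rule derived_img[symmetric]) simp
  also have "\<dots> = {\<one>\<^bsub>A\<^esub>}" by (rule A.derived_eq_singleton) auto
  finally have "\<psi> d = \<one>\<^bsub>A\<^esub>" using d by blast
  moreover have "d \<in> carrier G" using d derived_in_carrier[OF subset_refl] by blast
  ultimately show ?thesis using d assms(3) by simp
qed

text \<open>Surjectivity gives equality of the derived subgroup with its image, where a mere
  endomorphism gives an inclusion. Equality is essential, since \<open>conj_coset\<close> is an
  image of sets and has to be a full coset.\<close>

lemma (in Group.group) abelianization_image:
  assumes "\<kappa> \<in> hom G G" "\<kappa> ` carrier G = carrier G" "x \<in> carrier G"
  shows "\<kappa> ` (derived G (carrier G) #> x) = derived G (carrier G) #> \<kappa> x"
proof -
  interpret group_hom G G \<kappa> using assms(1) by unfold_locales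
  have img: "\<kappa> ` derived G (carrier G) = derived G (carrier G)"
    using derived_img[of "carrier G"] assms(2) by simp
  have sub: "derived G (carrier G) \<subseteq> carrier G" by (rule derived_in_carrier) simp
  have "\<kappa> ` (derived G (carrier G) #> x) = (\<lambda>d. \<kappa> d \<otimes> \<kappa> x) ` derived G (carrier G)"
    using sub assms(3) by (force simp: r_coset_def image_iff subset_iff)
  also have "\<dots> = (\<lambda>d. d \<otimes> \<kappa> x) ` (\<kappa> ` derived G (carrier G))" by (simp add: image_image)
  also have "\<dots> = derived G (carrier G) #> \<kappa> x" unfolding img by (auto simp: r_coset_def)
  finally show ?thesis .
qed

text \<open>Cocycles are not homomorphisms, but their values at products and inverses are determined
  by their values at the factors. Two cocycles therefore agree everywhere as soon as they agree on
  generators.\<close>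

lemma (in linear_representation) cocycle_equalizer_subgroup:
  assumes f: "f \<in> cocycles G V \<rho> (Suc 0)" and k: "k \<in> cocycles G V \<rho> (Suc 0)"
  shows "subgroup {g \<in> carrier G. f [g] = k [g]} G"
proof (rule G.subgroupI)
  show "{g \<in> carrier G. f [g] = k [g]} \<noteq> {}"
    using cocycle_one[OF f] cocycle_one[OF k] G.one_closed by force
qed (auto simp: cocycle_mult[OF f] cocycle_mult[OF k] cocycle_inv[OF f] cocycle_inv[OF k])

section \<open>Conjugation of C by constant upper triangular matrices\<close>

lemma upper_triangular_mult:
  fixes A B :: "'r::semiring_0 mat"
  assumes "A \<in> carrier_mat n n" "B \<in> carrier_mat n n" "upper_triangular A" "upper_triangular B"
  shows "upper_triangular (A * B)"
proof (rule upper_triangularI)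
  fix i j assume ij: "j < i" "i < dim_row (A * B)"
  have "A $$ (i, k) * B $$ (k, j) = 0" if "k < n" for k
    using assms ij that by (cases "k < i") (auto simp: upper_triangular_def)
  then show "(A * B) $$ (i, j) = 0"
    using assms ij by (simp add: scalar_prod_def)
qed

text \<open>Induction along row \<open>i\<close> of \<open>B\<close> from the left: once the earlier
  entries are zero, the entry \<open>(i, j)\<close> of \<open>B * A\<close> reduces to
  \<open>B $$ (i, j) * A $$ (j, j)\<close>, and the diagonal of \<open>A\<close> has no
  zero.\<close>

lemma upper_triangular_left_inverse:
  fixes A B :: "'a::field mat"
  assumes "A \<in> carrier_mat n n" "B \<in> carrier_mat n n" "upper_triangular A" "B * A = 1\<^sub>m n"
  shows "upper_triangular B"
proof -
  have "det B * det A = 1" using assms det_mult[of B n A] by simp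
  then have "det A \<noteq> 0" by auto
  then have diag: "A $$ (j, j) \<noteq> 0" if "j < n" for j
    using that unfolding prod_diag_upper_triangular[OF assms(1,3)] by auto
  have "B $$ (i, j) = 0" if "j < i" "i < n" for i j
    using that
  proof (induction j rule: less_induct)
    case (less j)
    have "0 = (B * A) $$ (i, j)" using less.prems assms(4) by simp
    also have "\<dots> = (\<Sum>k<n. B $$ (i, k) * A $$ (k, j))"
      using assms less.prems by (intro index_mult_mat_sum[of _ n n _ n]) auto
    also have "\<dots> = (\<Sum>k<n. if k = j then B $$ (i, j) * A $$ (j, j) else 0)"
    proof (intro sum.cong refl)
      fix k :: nat assume "k \<in> {..<n}"
      then show "B $$ (i, k) * A $$ (k, j) = (if k = j then B $$ (i, j) * A $$ (j, j) else 0)"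
        using less assms
        by (cases k j rule: linorder_cases) (auto simp: upper_triangular_def)
    qed
    also have "\<dots> = B $$ (i, j) * A $$ (j, j)" using less.prems by simp
    finally show ?case using diag[of j] less.prems by simp
  qed
  then show ?thesis using assms by (auto intro!: upper_triangularI)
qed

text \<open>Each of these conditions can be checked factor by factor on a product, which makes
  stability of C under conjugation by \<open>B\<close> immediate.\<close>

lemma upper_congruence_group_iff:
  fixes ty :: "'a::field itself"
  shows "A \<in> carrier (upper_congruence_group ty n) \<longleftrightarrow>
    A \<in> carrier (SL TYPE('a poly) n) \<and> upper_triangular A \<and> eval0 A = 1\<^sub>m n"
proof
  assume *: "A \<in> carrier (SL TYPE('a poly) n) \<and> upper_triangular A \<and> eval0 A = 1\<^sub>m n"
  then have "poly (A $$ (i, j)) 0 = (1\<^sub>m n :: 'a mat) $$ (i, j)" if "i < n" "j < n" for i j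
    using that by (metis SL_simps(1) carrier_matD eval0_def index_map_mat(1))
  then have "[:0, 1:] dvd A $$ (i, j) - 1\<^sub>m n $$ (i, j)" if "i < n" "j < n" for i j
    using that by (simp add: X_dvd_iff)
  then show "A \<in> carrier (upper_congruence_group ty n)"
    using * by (simp add: upper_congruence_group_def congruence_subgroup_def)
next
  assume A: "A \<in> carrier (upper_congruence_group ty n)"
  then show "A \<in> carrier (SL TYPE('a poly) n) \<and> upper_triangular A \<and> eval0 A = 1\<^sub>m n"
    using eval0_upper_congruence[OF A]
    by (simp add: upper_congruence_group_def congruence_subgroup_def)
qed

lemma upper_congruence_group:
  fixes ty :: "'a::field itself"
  shows "Group.group (upper_congruence_group ty n)"
  using Group.group.subgroup_imp_group[OF SL_group upper_congruence_group_subgroup[of ty n]]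
  by (simp add: upper_congruence_group_def)

lemma const_mat_inv:
  assumes "b \<in> carrier (SL TYPE('a::field) n)"
  shows "inv\<^bsub>SL TYPE('a poly) n\<^esub> (const_mat b) = const_mat (inv\<^bsub>SL TYPE('a) n\<^esub> b)"
proof -
  interpret group_hom "SL TYPE('a) n" "SL TYPE('a poly) n" const_mat
    by (intro group_hom.intro group_hom_axioms.intro const_mat_hom SL_group)
  show ?thesis using hom_inv[OF assms] by simp
qed

text \<open>The map on single matrices whose set image is \<open>conj_coset\<close>.\<close>

definition conj_const :: "nat \<Rightarrow> 'a::field mat \<Rightarrow> 'a poly mat \<Rightarrow> 'a poly mat" where
  "conj_const n b A = const_mat b * A * inv\<^bsub>SL TYPE('a poly) n\<^esub> (const_mat b)"

lemma conj_const_upper_congruence: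
  fixes ty :: "'a::field itself"
  assumes b: "b \<in> carrier (Borel ty n)" and A: "A \<in> carrier (upper_congruence_group ty n)"
  shows "conj_const n b A \<in> carrier (upper_congruence_group ty n)"
proof -
  interpret P: Group.group "SL TYPE('a poly) n" by (rule SL_group)
  have bm: "b \<in> carrier_mat n n" "det b = 1" "upper_triangular b"
    using b by (auto simp: carrier_Borel)
  define b' where "b' = inv\<^bsub>SL TYPE('a) n\<^esub> b"
  have b': "b' \<in> carrier_mat n n" "b' * b = 1\<^sub>m n" "b * b' = 1\<^sub>m n" "det b' = 1"
    using SL_inv_carrier[OF bm(1,2), of "TYPE('a)"] by (auto simp: b'_def)
  have up: "upper_triangular b'" by (rule upper_triangular_left_inverse[OF bm(1) b'(1) bm(3) b'(2)])
  have inv: "inv\<^bsub>SL TYPE('a poly) n\<^esub> (const_mat b) = const_mat b'"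
    unfolding b'_def using bm by (intro const_mat_inv) auto
  have upper: "upper_triangular (const_mat B)" if "upper_triangular B" "B \<in> carrier_mat n n" for B :: "'a mat"
    using that by (auto simp: const_mat_def upper_triangular_def)
  have Am: "A \<in> carrier_mat n n" "det A = 1" "upper_triangular A" "eval0 A = 1\<^sub>m n"
    using A unfolding upper_congruence_group_iff by auto
  have "upper_triangular (const_mat b * A * const_mat b')"
    using Am bm b' up upper by (intro upper_triangular_mult[of _ n]) auto
  moreover have "eval0 (const_mat b * A * const_mat b') = 1\<^sub>m n"
    using Am bm b' by (simp add: eval0_mult[of _ n] eval0_const_mat mult_carrier_mat[of _ n n _ n])
  moreover have "det (const_mat b * A * const_mat b') = 1"
    using Am bm b' by (simp add: det_mult[of _ n] const_mat_det mult_carrier_mat[of _ n n _ n])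
  ultimately show ?thesis
    unfolding conj_const_def inv upper_congruence_group_iff using Am bm b' by simp
qed

lemma conj_const_hom:
  fixes ty :: "'a::field itself"
  assumes b: "b \<in> carrier (Borel ty n)"
  shows "conj_const n b \<in> hom (upper_congruence_group ty n) (upper_congruence_group ty n)"
proof (rule homI)
  fix A B assume A: "A \<in> carrier (upper_congruence_group ty n)"
    and B: "B \<in> carrier (upper_congruence_group ty n)"
  show "conj_const n b A \<in> carrier (upper_congruence_group ty n)"
    by (rule conj_const_upper_congruence[OF b A])
  interpret P: Group.group "SL TYPE('a poly) n" by (rule SL_group)
  have c: "const_mat b \<in> carrier (SL TYPE('a poly) n)" "A \<in> carrier (SL TYPE('a poly) n)"
    "B \<in> carrier (SL TYPE('a poly) n)"
    using A B b unfolding upper_congruence_group_iff carrier_Borel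
    by (auto simp: const_mat_det)
  let ?P = "SL TYPE('a poly) n"
  define \<beta> \<beta>' where "\<beta> = const_mat b" and "\<beta>' = inv\<^bsub>?P\<^esub> const_mat b"
  have \<beta>: "\<beta> \<in> carrier ?P" "\<beta>' \<in> carrier ?P" "\<beta>' \<otimes>\<^bsub>?P\<^esub> \<beta> = \<one>\<^bsub>?P\<^esub>"
    using c P.inv_closed[OF c(1)] P.l_inv[OF c(1)] unfolding \<beta>_def \<beta>'_def by blast+
  have "(\<beta> \<otimes>\<^bsub>?P\<^esub> A \<otimes>\<^bsub>?P\<^esub> \<beta>') \<otimes>\<^bsub>?P\<^esub> (\<beta> \<otimes>\<^bsub>?P\<^esub> B \<otimes>\<^bsub>?P\<^esub> \<beta>') =
    \<beta> \<otimes>\<^bsub>?P\<^esub> (A \<otimes>\<^bsub>?P\<^esub> ((\<beta>' \<otimes>\<^bsub>?P\<^esub> \<beta>) \<otimes>\<^bsub>?P\<^esub> B)) \<otimes>\<^bsub>?P\<^esub> \<beta>'"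
    using \<beta>(1,2) c(2,3) by (simp only: P.m_assoc P.m_closed)
  also have "\<dots> = \<beta> \<otimes>\<^bsub>?P\<^esub> (A \<otimes>\<^bsub>?P\<^esub> B) \<otimes>\<^bsub>?P\<^esub> \<beta>'"
    unfolding \<beta>(3) P.l_one[OF c(3)] ..
  finally have "\<beta> \<otimes>\<^bsub>?P\<^esub> (A \<otimes>\<^bsub>?P\<^esub> B) \<otimes>\<^bsub>?P\<^esub> \<beta>' =
    (\<beta> \<otimes>\<^bsub>?P\<^esub> A \<otimes>\<^bsub>?P\<^esub> \<beta>') \<otimes>\<^bsub>?P\<^esub> (\<beta> \<otimes>\<^bsub>?P\<^esub> B \<otimes>\<^bsub>?P\<^esub> \<beta>')" ..
  then show "conj_const n b (A \<otimes>\<^bsub>upper_congruence_group ty n\<^esub> B) =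
    conj_const n b A \<otimes>\<^bsub>upper_congruence_group ty n\<^esub> conj_const n b B"
    unfolding \<beta>_def \<beta>'_def by (simp add: conj_const_def upper_congruence_group_def)
qed

lemma conj_const_commutes:
  assumes "b \<in> carrier (SL TYPE('a::field) n)" "A \<in> carrier_mat n n" "B \<in> carrier_mat n n"
    and "const_mat b * A = B * const_mat b"
  shows "conj_const n b A = B"
proof -
  have b: "const_mat b \<in> carrier_mat n n" "det (const_mat b) = 1"
    using assms by (auto simp: const_mat_det)
  note i = SL_inv_carrier[OF b, of "TYPE('a poly)"]
  show ?thesis
    unfolding conj_const_def assms(4) using assms(3) b i
    by (simp add: assoc_mult_mat[of _ n n _ n _ n])
qed

text \<open>Conjugation by the inverse of \<open>b\<close>, again an element of \<open>B\<close>,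
  provides the preimage. This is the surjectivity that \<open>abelianization_image\<close> asks
  for.\<close>

lemma conj_const_image:
  fixes ty :: "'a::field itself"
  assumes b: "b \<in> carrier (Borel ty n)"
  shows "conj_const n b ` carrier (upper_congruence_group ty n) = carrier (upper_congruence_group ty n)"
proof
  show "conj_const n b ` carrier (upper_congruence_group ty n) \<subseteq> carrier (upper_congruence_group ty n)"
    using conj_const_upper_congruence[OF b] by blast
  show "carrier (upper_congruence_group ty n) \<subseteq> conj_const n b ` carrier (upper_congruence_group ty n)"
  proof
    fix A assume A: "A \<in> carrier (upper_congruence_group ty n)"
    have bm: "b \<in> carrier_mat n n" "det b = 1" "upper_triangular b"
      using b by (auto simp: carrier_Borel)
    define b' where "b' = inv\<^bsub>SL TYPE('a) n\<^esub> b"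
    have b': "b' \<in> carrier_mat n n" "b' * b = 1\<^sub>m n" "b * b' = 1\<^sub>m n" "det b' = 1"
      using SL_inv_carrier[OF bm(1,2), of "TYPE('a)"] by (auto simp: b'_def)
    have B: "b' \<in> carrier (Borel ty n)"
      using upper_triangular_left_inverse[OF bm(1) b'(1) bm(3) b'(2)] b' by (simp add: carrier_Borel)
    let ?P = "SL TYPE('a poly) n" and ?A = "conj_const n b' A"
    interpret P: Group.group ?P by (rule SL_group)
    define \<beta> \<beta>' where "\<beta> = const_mat b" and "\<beta>' = inv\<^bsub>?P\<^esub> const_mat b"
    have c: "\<beta> \<in> carrier ?P" "A \<in> carrier ?P"
      using A bm by (auto simp: \<beta>_def upper_congruence_group_iff const_mat_det)
    have \<beta>': "\<beta>' \<in> carrier ?P" "\<beta> \<otimes>\<^bsub>?P\<^esub> \<beta>' = \<one>\<^bsub>?P\<^esub>" "inv\<^bsub>?P\<^esub> \<beta>' = \<beta>" "const_mat b' = \<beta>'"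
      using P.inv_closed[OF c(1)] P.r_inv[OF c(1)] P.inv_inv[OF c(1)] const_mat_inv[of b n] bm
      unfolding \<beta>_def \<beta>'_def b'_def by auto
    have "\<beta> \<otimes>\<^bsub>?P\<^esub> (\<beta>' \<otimes>\<^bsub>?P\<^esub> A \<otimes>\<^bsub>?P\<^esub> \<beta>) \<otimes>\<^bsub>?P\<^esub> \<beta>'
      = (\<beta> \<otimes>\<^bsub>?P\<^esub> \<beta>') \<otimes>\<^bsub>?P\<^esub> A \<otimes>\<^bsub>?P\<^esub> (\<beta> \<otimes>\<^bsub>?P\<^esub> \<beta>')"
      using \<beta>'(1) c by (simp only: P.m_assoc P.m_closed)
    also have "\<dots> = A" unfolding \<beta>'(2) P.l_one[OF c(2)] P.r_one[OF c(2)] ..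
    finally have "conj_const n b ?A = A"
      unfolding conj_const_def[of n b'] \<beta>'(3,4) unfolding conj_const_def \<beta>_def \<beta>'_def by simp
    moreover have "?A \<in> carrier (upper_congruence_group ty n)"
      by (rule conj_const_upper_congruence[OF B A])
    ultimately show "A \<in> conj_const n b ` carrier (upper_congruence_group ty n)" by force
  qed
qed

lemma conj_coset_image:
  fixes ty :: "'a::field itself"
  assumes b: "b \<in> carrier (Borel ty n)" and A: "A \<in> carrier (upper_congruence_group ty n)"
  shows "conj_coset n b (derived (upper_congruence_group ty n) (carrier (upper_congruence_group ty n))
      #>\<^bsub>upper_congruence_group ty n\<^esub> A) =
    derived (upper_congruence_group ty n) (carrier (upper_congruence_group ty n))
      #>\<^bsub>upper_congruence_group ty n\<^esub> conj_const n b A"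
  using group.abelianization_image[OF upper_congruence_group conj_const_hom[OF b]
      conj_const_image[OF b] A]
  by (simp add: conj_coset_def conj_const_def)

text \<open>Since F[t] is Euclidean, it is enough to find every elementary matrix in
  \<open>H\<close>. Above the diagonal, e_ij(p) is the product of e_ij(p - p(0)), which lies in C,
  and the constant e_ij(p(0)). Below the diagonal, commutators with a constant matrix do the
  work.\<close>

lemma generated_by_constants_and_upper:
  fixes ty :: "'a::field itself"
  assumes n: "n \<ge> 3" and H: "subgroup H (SL TYPE('a poly) n)"
    and const: "const_mat ` carrier (SL ty n) \<subseteq> H"
    and upper: "carrier (upper_congruence_group ty n) \<subseteq> H"
  shows "H = carrier (SL TYPE('a poly) n)"
proof -
  interpret P: Group.group "SL TYPE('a poly) n" by (rule SL_group)
  interpret H: subgroup H "SL TYPE('a poly) n" by fact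
  have mult: "A * B \<in> H" if "A \<in> H" "B \<in> H" for A B
    using H.m_closed[OF that] by simp
  have const_elem: "addrow_mat n [:a:] i j \<in> H" if "i \<noteq> j" for a i j
    using const addrow_mat_SL[OF that, of n a ty] by (force simp: const_mat_addrow_mat[symmetric])
  have upper_elem: "addrow_mat n p i j \<in> H" if "i < j" "j < n" for p i j
  proof -
    have "addrow_mat n (p - [:poly p 0:]) i j \<in> H"
      using addrow_mat_upper_congruence[OF that, of "p - [:poly p 0:]" ty] upper
      by (auto simp: X_dvd_iff)
    from mult[OF this const_elem[of i j "poly p 0"]] show ?thesis
      using that by (simp add: addrow_mat_add)
  qed
  have commutator: "addrow_mat n (p * q) i k \<in> H"
    if ijk: "i < n" "j < n" "k < n" "i \<noteq> j" "j \<noteq> k" "i \<noteq> k"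
      and E: "addrow_mat n p i j \<in> H" and F: "addrow_mat n q j k \<in> H" for p q i j k
  proof -
    let ?P = "SL TYPE('a poly) n" and ?E = "addrow_mat n p i j" and ?F = "addrow_mat n q j k"
    let ?G = "addrow_mat n (p * q) i k"
    have FE: "?F * ?E \<in> H" by (rule mult[OF F E])
    have "?E \<otimes>\<^bsub>?P\<^esub> ?F = ?G \<otimes>\<^bsub>?P\<^esub> (?F * ?E)"
      using addrow_mat_commutator[OF ijk] by simp
    then have "?G = (?E \<otimes>\<^bsub>?P\<^esub> ?F) \<otimes>\<^bsub>?P\<^esub> inv\<^bsub>?P\<^esub> (?F * ?E)"
      using H.subset E F FE
      by (intro iffD2[OF P.inv_solve_right] P.m_closed addrow_mat_SL[OF ijk(6)]) blast+
    moreover have "(?E \<otimes>\<^bsub>?P\<^esub> ?F) \<otimes>\<^bsub>?P\<^esub> inv\<^bsub>?P\<^esub> (?F * ?E) \<in> H"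
      using E F FE by (intro H.m_closed H.m_inv_closed)
    ultimately show ?thesis by simp
  qed
  \<comment> \<open>The lower elementary matrices are commutators of a constant and an upper one, except for the
    corner \<open>(n - 1, 0)\<close>, which is reached in a second step through the index \<open>1\<close>.\<close>
  have lower_elem: "addrow_mat n p i j \<in> H" if "j < i" "i < n" "j > 0" for p i j
    using commutator[of i 0 j "[:1:]" p] const_elem[of i 0 1] upper_elem[of 0 j p] that by simp
  have elem: "addrow_mat n p i j \<in> H" if ij: "i < n" "j < n" "i \<noteq> j" for p i j
  proof -
    consider "i < j" | "j < i" "j > 0" | "j = 0" "0 < i" "i < n - 1" | "j = 0" "i = n - 1"
      using ij by linarith
    then show ?thesis
    proof cases
      case 3
      then show ?thesis
        using commutator[of i "n - 1" 0 p "[:1:]"] const_elem[of "n - 1" 0 1] upper_elem[of i "n - 1" p] ij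
        by simp
    next
      case 4
      then show ?thesis
        using commutator[of "n - 1" 1 0 p "[:1:]"] const_elem[of 1 0 1] lower_elem[of 1 "n - 1" p] n
        by simp
    qed (use upper_elem lower_elem ij in auto)
  qed
  have "A \<in> H" if "A \<in> carrier_mat n n" "det A = 1" for A
  proof (rule SL_elementary_induct[OF that])
    show "1\<^sub>m n \<in> H" using H.one_closed by simp
  next
    fix B :: "'a poly mat" and a i j
    assume B: "B \<in> carrier_mat n n" "det B = 1" and ij: "i < n" "j < n" "i \<noteq> j"
      and *: "addrow a i j B \<in> H"
    have "addrow_mat n (- a) i j * (addrow_mat n a i j * B) = B"
      using B ij addrow_mat_inv[OF ij, of "- a"]
      by (subst assoc_mult_mat[symmetric, of _ n n _ n _ n]) auto
    moreover have "addrow_mat n (- a) i j * (addrow_mat n a i j * B) \<in> H"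
      using mult[OF elem[OF ij]] * addrow_mat[OF B(1) ij(2)] by simp
    ultimately show "B \<in> H" by simp
  qed
  then show ?thesis using H.subset by auto
qed

section \<open>The splitting\<close>

lemma equivariant_homs_simps:
  "\<phi> \<oplus>\<^bsub>equivariant_homs B A \<alpha> V \<rho>\<^esub> \<psi> = (\<lambda>x\<in>carrier A. \<phi> x \<oplus>\<^bsub>V\<^esub> \<psi> x)"
  "a \<odot>\<^bsub>equivariant_homs B A \<alpha> V \<rho>\<^esub> \<phi> = (\<lambda>x\<in>carrier A. a \<odot>\<^bsub>V\<^esub> \<phi> x)"
  by (simp_all add: equivariant_homs_def)

lemma direct_sum_simps:
  "carrier (direct_sum M N) = carrier M \<times> carrier N"
  "x \<oplus>\<^bsub>direct_sum M N\<^esub> y = (fst x \<oplus>\<^bsub>M\<^esub> fst y, snd x \<oplus>\<^bsub>N\<^esub> snd y)"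
  "a \<odot>\<^bsub>direct_sum M N\<^esub> x = (a \<odot>\<^bsub>M\<^esub> fst x, a \<odot>\<^bsub>N\<^esub> snd x)"
  by (simp_all add: direct_sum_def)

section \<open>The logarithmic derivative at 0 as a cocycle\<close>

definition log_deriv :: "nat \<Rightarrow> 'a::field poly mat \<Rightarrow> 'a mat" where
  "log_deriv n A = deriv0 A * inv\<^bsub>SL TYPE('a) n\<^esub> (eval0 A)"

text \<open>The derivative at 0 of the product is A'(0) B(0) + A(0) B'(0). Multiplied on the right
  by the inverse of A(0) B(0), the first term loses B(0) and the second becomes a conjugate by A(0),
  which is exactly the cocycle rule.\<close>

lemma log_deriv_mult:
  fixes A B :: "'a::field poly mat"
  assumes A: "A \<in> carrier (SL TYPE('a poly) n)" and B: "B \<in> carrier (SL TYPE('a poly) n)"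
  shows "log_deriv n (A * B) = log_deriv n A + Ad n (eval0 A) (log_deriv n B)"
proof -
  interpret G: Group.group "SL TYPE('a) n" by (rule SL_group)
  define a b where "a = eval0 A" and "b = eval0 B"
  define a' b' where "a' = inv\<^bsub>SL TYPE('a) n\<^esub> a" and "b' = inv\<^bsub>SL TYPE('a) n\<^esub> b"
  have ab: "a \<in> carrier (SL TYPE('a) n)" "b \<in> carrier (SL TYPE('a) n)"
    using A B by (auto simp: a_def b_def eval0_det)
  have c: "a \<in> carrier_mat n n" "b \<in> carrier_mat n n" "a' \<in> carrier_mat n n" "b' \<in> carrier_mat n n"
    and bb': "b * b' = 1\<^sub>m n"
    using ab SL_inv_carrier unfolding a'_def b'_def by auto
  have d: "deriv0 A \<in> carrier_mat n n" "deriv0 B \<in> carrier_mat n n" using A B by auto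
  have inv: "inv\<^bsub>SL TYPE('a) n\<^esub> (eval0 (A * B)) = b' * a'"
    using G.inv_mult_group[OF ab] A B by (simp add: eval0_mult[of _ n] a_def b_def a'_def b'_def)
  have "deriv0 A * b * (b' * a') = deriv0 A * (b * b') * a'"
    using c d by (simp only: assoc_mult_mat[of _ n n _ n _ n] mult_carrier_mat[of _ n n _ n])
  then have 1: "deriv0 A * b * (b' * a') = deriv0 A * a'" unfolding bb' using c d by simp
  have "log_deriv n (A * B) = (deriv0 A * b + a * deriv0 B) * (b' * a')"
    unfolding log_deriv_def inv using deriv0_mult[of A n B] A B by (simp add: a_def b_def)
  also have "\<dots> = deriv0 A * b * (b' * a') + a * deriv0 B * (b' * a')"
    using c d by (intro add_mult_distrib_mat[of _ n n _ _ n]) auto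
  also have "a * deriv0 B * (b' * a') = a * (deriv0 B * b') * a'"
    using c d by (simp only: assoc_mult_mat[of _ n n _ n _ n] mult_carrier_mat[of _ n n _ n])
  finally show ?thesis
    unfolding 1 by (simp add: log_deriv_def Ad_def a_def b_def a'_def b'_def)
qed

lemma log_deriv_carrier:
  fixes A :: "'a::field poly mat"
  assumes "A \<in> carrier (SL TYPE('a poly) n)"
  shows "log_deriv n A \<in> carrier_mat n n"
proof -
  have "eval0 A \<in> carrier_mat n n" "det (eval0 A) = 1" using assms by (auto simp: eval0_det)
  from SL_inv_carrier(1)[OF this, of "TYPE('a)"] show ?thesis
    using assms unfolding log_deriv_def by (intro mult_carrier_mat[of _ n n]) auto
qed

lemma log_deriv_sl:
  fixes A :: "'a::field poly mat" and ty :: "'a itself"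
  assumes "A \<in> carrier (SL TYPE('a poly) n)"
  shows "log_deriv n A \<in> carrier (sl_module ty n)"
proof -
  \<comment> \<open>The trace of \<open>log_deriv\<close> is a homomorphism to \<open>F\<close> that kills the elementary matrices.\<close>
  have "(\<Sum>i<n. log_deriv n A $$ (i, i)) = 0"
  proof (rule SL_elementary_induct[of A n])
    show "A \<in> carrier_mat n n" "det A = 1" using assms by auto
    show "(\<Sum>i<n. log_deriv n (1\<^sub>m n :: 'a poly mat) $$ (i, i)) = 0"
    proof -
      have "deriv0 (1\<^sub>m n :: 'a poly mat) = 0\<^sub>m n n" by (intro eq_matI) (auto simp: deriv0_def)
      then show ?thesis
        using SL_inv_carrier(1)[of "1\<^sub>m n :: 'a mat" n "TYPE('a)"] by (simp add: log_deriv_def eval0_one)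
    qed
  next
    fix B :: "'a poly mat" and a i j
    assume B: "B \<in> carrier_mat n n" "det B = 1" and ij: "i < n" "j < n" "i \<noteq> j"
      and IH: "(\<Sum>k<n. log_deriv n (addrow a i j B) $$ (k, k)) = 0"
    let ?E = "addrow_mat n a i j"
    have E: "?E \<in> carrier (SL TYPE('a poly) n)" and Bc: "B \<in> carrier (SL TYPE('a poly) n)"
      using addrow_mat_SL[OF ij(3)] B by auto
    have e: "eval0 ?E \<in> carrier (SL TYPE('a) n)" using E by (auto simp: eval0_det)
    \<comment> \<open>The only possibly nonzero entry of \<open>deriv0 ?E\<close> is at
      \<open>(i, j)\<close>, so the column operation adds a multiple of the zero column
      \<open>i\<close>, and the diagonal remains zero.\<close>
    have "log_deriv n ?E = addcol (- poly a 0) j i (deriv0 ?E)"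
      unfolding log_deriv_def eval0_addrow_mat SL_inv_addrow_mat[OF ij]
      using ij by (intro addcol_mat[symmetric]) auto
    then have E0: "(\<Sum>k<n. log_deriv n ?E $$ (k, k)) = 0"
      using ij by (auto simp: deriv0_addrow_mat mat_addcol_def intro!: sum.neutral)
    have "(\<Sum>k<n. log_deriv n (?E * B) $$ (k, k)) =
      (\<Sum>k<n. log_deriv n ?E $$ (k, k)) + (\<Sum>k<n. Ad n (eval0 ?E) (log_deriv n B) $$ (k, k))"
      unfolding log_deriv_mult[OF E Bc] sum.distrib[symmetric]
      using Ad_carrier(1)[OF e log_deriv_carrier[OF Bc]]
      by (intro sum.cong) auto
    then show "(\<Sum>k<n. log_deriv n B $$ (k, k)) = 0"
      using IH addrow_mat[OF B(1) ij(2), of a i] E0 sum_diag_Ad[OF e log_deriv_carrier[OF Bc]] by simp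
  qed
  then show ?thesis using log_deriv_carrier[OF assms] by simp
qed

lemma log_deriv_const_mat:
  fixes g :: "'a::field mat"
  assumes "g \<in> carrier (SL TYPE('a) n)"
  shows "log_deriv n (const_mat g) = 0\<^sub>m n n"
proof -
  have g: "g \<in> carrier_mat n n" "det g = 1" using assms by auto
  show ?thesis
    using SL_inv_carrier(1)[OF g, of "TYPE('a)"]
    by (simp add: log_deriv_def deriv0_const_mat[OF g(1)] eval0_const_mat left_mult_zero_mat[of _ n n])
qed

lemma log_deriv_upper_congruence:
  fixes ty :: "'a::field itself"
  assumes "A \<in> carrier (upper_congruence_group ty n)"
  shows "log_deriv n A = deriv0 A"
proof -
  interpret G: Group.group "SL TYPE('a) n" by (rule SL_group)
  have A: "A \<in> carrier_mat n n" "eval0 A = 1\<^sub>m n"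
    using assms unfolding upper_congruence_group_iff by auto
  have "inv\<^bsub>SL TYPE('a) n\<^esub> (1\<^sub>m n) = 1\<^sub>m n" using G.inv_one by simp
  then show ?thesis using A right_mult_one_mat[of "deriv0 A" n n] by (simp add: log_deriv_def)
qed

text \<open>Composition with the projection from C to C/[C, C] turns \<open>\<phi>\<close> into a
  map on matrices, to which \<open>\<psi>_eq_deriv0\<close> applies.\<close>

lemma equivariant_hom_eq_deriv0:
  fixes F :: "'a::field_char_0 itself" and n :: nat
  defines "C \<equiv> upper_congruence_group F n"
  assumes n: "n \<ge> 3"
    and \<phi>: "\<phi> \<in> carrier (equivariant_homs (Borel F n) (abelianization C) (conj_coset n)
      (sl_module F n) (Ad n))"
  shows "\<exists>c. \<forall>A\<in>carrier C. \<phi> (derived C (carrier C) #>\<^bsub>C\<^esub> A) = c \<cdot>\<^sub>m deriv0 A"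
proof -
  interpret C: Group.group C unfolding C_def by (rule upper_congruence_group)
  have carrier: "A \<in> carrier C \<longleftrightarrow> unitriangular_mod [:0, 1:] n A" for A
    unfolding C_def by (rule carrier_upper_congruence_group)
  define \<psi> where "\<psi> A = \<phi> (derived C (carrier C) #>\<^bsub>C\<^esub> A)" for A
  have coset: "derived C (carrier C) #>\<^bsub>C\<^esub> A \<in> carrier (abelianization C)" if "A \<in> carrier C" for A
    using that by (simp add: carrier_abelianization)
  have closed: "\<psi> A \<in> carrier (sl_module F n)" if "A \<in> carrier C" for A
    using \<phi> coset[OF that] by (auto simp: equivariant_homs_def \<psi>_def simp del: sl_module_simps)
  have mult: "\<psi> (A * B) = \<psi> A + \<psi> B" if "A \<in> carrier C" "B \<in> carrier C" for A B
  proof -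
    have "\<phi> \<in> hom (abelianization C) (add_monoid (sl_module F n))"
      using \<phi> by (simp add: equivariant_homs_def del: sl_module_simps)
    from hom_mult[OF this coset[OF that(1)] coset[OF that(2)]]
    show ?thesis
      unfolding C.abelianization_mult[OF that]
      by (simp add: \<psi>_def C_def upper_congruence_group_def)
  qed
  have equivariant: "\<psi> A' * b = b * \<psi> A"
    if "b \<in> carrier (Borel TYPE('a) n)" "A \<in> carrier C" "A' \<in> carrier C"
      "const_mat b * A = A' * const_mat b" for b A A'
  proof -
    have b: "b \<in> carrier (Borel F n)" using that(1) by (simp add: Borel_def SL_def)
    have b': "b \<in> carrier (SL TYPE('a) n)" using that(1) by (simp add: carrier_Borel)
    have "conj_const n b A = A'"
      using that b' by (intro conj_const_commutes) (auto simp: carrier unitriangular_mod_def)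
    then have "conj_coset n b (derived C (carrier C) #>\<^bsub>C\<^esub> A) = derived C (carrier C) #>\<^bsub>C\<^esub> A'"
      using conj_coset_image[OF b, of A] that(2) by (simp add: C_def)
    moreover have "\<phi> (conj_coset n b (derived C (carrier C) #>\<^bsub>C\<^esub> A)) = Ad n b (\<psi> A)"
      using \<phi> b coset[OF that(2)] unfolding \<psi>_def equivariant_homs_def by simp
    ultimately have "\<psi> A' = Ad n b (\<psi> A)" by (simp only: \<psi>_def)
    then show ?thesis using Ad_carrier(2)[OF b'] closed[OF that(2)] by simp
  qed
  have "\<psi> A = root_coeff n \<psi> 0 (n - 1) [:0, 1:] \<cdot>\<^sub>m deriv0 A" if "A \<in> carrier C" for A
    using n
  proof (rule \<psi>_eq_deriv0)
    show "\<psi> A \<in> carrier_mat n n" if "unitriangular_mod [:0, 1:] n A" for A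
      using closed[of A] that by (simp add: carrier)
  qed (use mult equivariant that in \<open>auto simp: carrier\<close>)
  then show ?thesis unfolding \<psi>_def by blast
qed

section \<open>Restriction of cocycles to the constants and to C\<close>

context
  fixes F :: "'a::field_char_0 itself" and n :: nat
  assumes n: "n \<ge> 3"
begin

abbreviation (input) "SL_poly \<equiv> SL TYPE('a poly) n"
abbreviation (input) "sl \<equiv> sl_module F n"
abbreviation (input) "upper \<equiv> upper_congruence_group F n"
abbreviation (input) "Ad_eval0 \<equiv> \<lambda>A :: 'a poly mat. Ad n (eval0 A)"
abbreviation (input) "coset A \<equiv> derived upper (carrier upper) #>\<^bsub>upper\<^esub> A"
abbreviation (input) "homs \<equiv> equivariant_homs (Borel F n) (abelianization upper) (conj_coset n) sl (Ad n)"

interpretation SL_rep: linear_representation "SL F n" class_ring sl "Ad n"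
  by (rule Ad_representation)

interpretation P_rep: linear_representation SL_poly class_ring sl Ad_eval0
  by (rule SL_rep.pullback[OF SL_group eval0_hom])

interpretation upper: Group.group upper
  by (rule upper_congruence_group)

definition restrict_const :: "('a poly mat list \<Rightarrow> 'a mat) \<Rightarrow> 'a mat list \<Rightarrow> 'a mat" where
  "restrict_const f = (\<lambda>gs\<in>tuples (SL F n) (Suc 0). f [const_mat (hd gs)])"

text \<open>The value is taken at an arbitrary representative of the coset; for a cocycle
  \<open>restrict_upper_coset\<close> removes the dependence on this choice.\<close>

definition restrict_upper :: "('a poly mat list \<Rightarrow> 'a mat) \<Rightarrow> 'a poly mat set \<Rightarrow> 'a mat" where
  "restrict_upper f = (\<lambda>X\<in>carrier (abelianization upper). f [SOME A. A \<in> X])"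

lemma const_mat_SL: "g \<in> carrier (SL F n) \<Longrightarrow> const_mat g \<in> carrier SL_poly"
  using const_mat_hom by (rule hom_in_carrier)

lemma upper_SL: "A \<in> carrier upper \<Longrightarrow> A \<in> carrier SL_poly"
  unfolding upper_congruence_group_iff by blast

lemma restrict_const_eq: "g \<in> carrier (SL F n) \<Longrightarrow> restrict_const f [g] = f [const_mat g]"
  by (simp add: restrict_const_def tuples_1 del: SL_simps)

lemma restrict_const_cocycle:
  assumes f: "f \<in> cocycles SL_poly sl Ad_eval0 (Suc 0)"
  shows "restrict_const f \<in> cocycles (SL F n) sl (Ad n) (Suc 0)"
  unfolding SL_rep.cocycles_1 carrier_cochains_1
proof (intro conjI ballI)
  fix g assume g: "g \<in> carrier (SL F n)"
  show "restrict_const f [g] \<in> carrier sl"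
    unfolding restrict_const_eq[OF g] by (rule P_rep.cocycle_closed[OF f const_mat_SL[OF g]])
  fix h assume h: "h \<in> carrier (SL F n)"
  have gh: "g \<otimes>\<^bsub>SL F n\<^esub> h \<in> carrier (SL F n)" using g h by (rule SL_rep.G.m_closed)
  have "const_mat (g \<otimes>\<^bsub>SL F n\<^esub> h) = const_mat g \<otimes>\<^bsub>SL_poly\<^esub> const_mat h"
    using g h const_mat_mult[of g n h] by simp
  then show "restrict_const f [g \<otimes>\<^bsub>SL F n\<^esub> h] =
      restrict_const f [g] \<oplus>\<^bsub>sl\<^esub> Ad n g (restrict_const f [h])"
    unfolding restrict_const_eq[OF g] restrict_const_eq[OF h] restrict_const_eq[OF gh]
    using P_rep.cocycle_mult[OF f const_mat_SL[OF g] const_mat_SL[OF h]]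
    by (simp only: eval0_const_mat)
qed (simp add: restrict_const_def)

lemma upper_cocycle_hom:
  assumes f: "f \<in> cocycles SL_poly sl Ad_eval0 (Suc 0)"
  shows "(\<lambda>A. f [A]) \<in> hom upper (add_monoid sl)"
proof (rule homI)
  fix A B assume A: "A \<in> carrier upper" and B: "B \<in> carrier upper"
  show "f [A] \<in> carrier (add_monoid sl)"
    using P_rep.cocycle_closed[OF f upper_SL[OF A]] by simp
  have "A \<otimes>\<^bsub>upper\<^esub> B = A \<otimes>\<^bsub>SL_poly\<^esub> B" by (simp add: upper_congruence_group_def)
  moreover have "Ad_eval0 A (f [B]) = f [B]"
    using eval0_upper_congruence[OF A] SL_rep.action_one[OF P_rep.cocycle_closed[OF f upper_SL[OF B]]]
    by simp
  ultimately show "f [A \<otimes>\<^bsub>upper\<^esub> B] = f [A] \<otimes>\<^bsub>add_monoid sl\<^esub> f [B]"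
    using P_rep.cocycle_mult[OF f upper_SL[OF A] upper_SL[OF B]] by simp
qed

lemma some_coset:
  assumes "A \<in> carrier upper"
  shows "(SOME B. B \<in> coset A) \<in> coset A"
proof (rule someI)
  show "A \<in> coset A"
    using upper.rcos_self[OF assms] upper.derived_is_subgroup[OF subset_refl] by blast
qed

lemma coset_carrier: "A \<in> carrier upper \<Longrightarrow> coset A \<in> carrier (abelianization upper)"
  by (simp add: carrier_abelianization)

lemma restrict_upper_coset:
  assumes f: "f \<in> cocycles SL_poly sl Ad_eval0 (Suc 0)" and A: "A \<in> carrier upper"
  shows "restrict_upper f (coset A) = f [A]"
proof -
  have "comm_group (add_monoid sl)" by (rule SL_rep.M.a_comm_group)
  from upper.hom_abelianization_coset[OF this upper_cocycle_hom[OF f] A some_coset[OF A]]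
  show ?thesis unfolding restrict_upper_def using coset_carrier[OF A] by simp
qed

text \<open>Let A' be the conjugate of A by the constant matrix \<beta>. Expanding \<open>f\<close>
  at A' \<beta> = \<beta> A in both ways avoids inverses, and the two values at \<beta> cancel
  because A' lies in C and acts trivially.\<close>

lemma upper_cocycle_conj:
  assumes f: "f \<in> cocycles SL_poly sl Ad_eval0 (Suc 0)" and b: "b \<in> carrier (Borel F n)" and A: "A \<in> carrier upper"
  shows "f [conj_const n b A] = Ad n b (f [A])"
proof -
  have bS: "b \<in> carrier (SL F n)" using b by (simp add: carrier_Borel)
  let ?\<beta> = "const_mat b"
  have \<beta>: "?\<beta> \<in> carrier SL_poly" by (rule const_mat_SL[OF bS])
  have K: "conj_const n b A \<in> carrier upper" by (rule conj_const_upper_congruence[OF b A])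
  have bm: "?\<beta> \<in> carrier_mat n n" "det ?\<beta> = 1" using \<beta> by simp_all
  have Am: "A \<in> carrier_mat n n" using upper_SL[OF A] by simp
  note i = SL_inv_carrier[OF bm, of "TYPE('a poly)"]
  have "conj_const n b A \<otimes>\<^bsub>SL_poly\<^esub> ?\<beta> = ?\<beta> \<otimes>\<^bsub>SL_poly\<^esub> A"
    unfolding conj_const_def using bm Am i by (simp add: assoc_mult_mat[of _ n n _ n _ n])
  then have "f [conj_const n b A] \<oplus>\<^bsub>sl\<^esub> Ad_eval0 (conj_const n b A) (f [?\<beta>]) = f [?\<beta>] \<oplus>\<^bsub>sl\<^esub> Ad_eval0 ?\<beta> (f [A])"
    using P_rep.cocycle_mult[OF f upper_SL[OF K] \<beta>] P_rep.cocycle_mult[OF f \<beta> upper_SL[OF A]]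
    by simp
  moreover have "Ad_eval0 (conj_const n b A) (f [?\<beta>]) = f [?\<beta>]"
    using eval0_upper_congruence[OF K] SL_rep.action_one[OF P_rep.cocycle_closed[OF f \<beta>]] by simp
  moreover have "Ad_eval0 ?\<beta> (f [A]) = Ad n b (f [A])" by (simp add: eval0_const_mat)
  ultimately have eq: "f [conj_const n b A] \<oplus>\<^bsub>sl\<^esub> f [?\<beta>] = f [?\<beta>] \<oplus>\<^bsub>sl\<^esub> Ad n b (f [A])" by simp
  have c: "f [conj_const n b A] \<in> carrier sl" "f [?\<beta>] \<in> carrier sl" "Ad n b (f [A]) \<in> carrier sl"
    using P_rep.cocycle_closed[OF f upper_SL[OF K]] P_rep.cocycle_closed[OF f \<beta>]
      SL_rep.action_closed[OF bS P_rep.cocycle_closed[OF f upper_SL[OF A]]] .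
  show ?thesis
    using eq SL_rep.M.a_comm[OF c(2,3)] SL_rep.M.add.right_cancel[OF c(2,1,3)] by simp
qed

lemma restrict_upper_hom:
  assumes f: "f \<in> cocycles SL_poly sl Ad_eval0 (Suc 0)"
  shows "restrict_upper f \<in> carrier homs"
proof -
  have val: "restrict_upper f (coset A) \<in> carrier sl" if "A \<in> carrier upper" for A
    unfolding restrict_upper_coset[OF f that] by (rule P_rep.cocycle_closed[OF f upper_SL[OF that]])
  have "restrict_upper f \<in> carrier (abelianization upper) \<rightarrow>\<^sub>E carrier sl"
  proof (rule PiE_I)
    fix X assume "X \<in> carrier (abelianization upper)"
    then obtain A where "A \<in> carrier upper" "X = coset A" unfolding carrier_abelianization by blast
    then show "restrict_upper f X \<in> carrier sl" using val by blast
  qed (simp add: restrict_upper_def)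
  moreover have "restrict_upper f \<in> hom (abelianization upper) (add_monoid sl)"
  proof (rule homI)
    fix X Y assume "X \<in> carrier (abelianization upper)" "Y \<in> carrier (abelianization upper)"
    then obtain A B where A: "A \<in> carrier upper" "X = coset A" and B: "B \<in> carrier upper" "Y = coset B"
      unfolding carrier_abelianization by blast
    show "restrict_upper f X \<in> carrier (add_monoid sl)" using val[OF A(1)] A(2) by simp
    show "restrict_upper f (X \<otimes>\<^bsub>abelianization upper\<^esub> Y) =
        restrict_upper f X \<otimes>\<^bsub>add_monoid sl\<^esub> restrict_upper f Y"
      unfolding A(2) B(2) upper.abelianization_mult[OF A(1) B(1)]
        restrict_upper_coset[OF f A(1)] restrict_upper_coset[OF f B(1)]
        restrict_upper_coset[OF f upper.m_closed[OF A(1) B(1)]]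
      by (rule hom_mult[OF upper_cocycle_hom[OF f] A(1) B(1)])
  qed
  moreover have "restrict_upper f (conj_coset n b X) = Ad n b (restrict_upper f X)"
    if b: "b \<in> carrier (Borel F n)" and X: "X \<in> carrier (abelianization upper)" for b X
  proof -
    obtain A where A: "A \<in> carrier upper" "X = coset A"
      using X unfolding carrier_abelianization by blast
    show ?thesis
      unfolding A(2) conj_coset_image[OF b A(1)] restrict_upper_coset[OF f A(1)]
        restrict_upper_coset[OF f conj_const_upper_congruence[OF b A(1)]]
      by (rule upper_cocycle_conj[OF f b A(1)])
  qed
  ultimately show ?thesis by (simp add: equivariant_homs_def del: SL_simps sl_module_simps)
qed

abbreviation (input) "cocycle_mod \<equiv> (cochains SL_poly sl (Suc 0))\<lparr>carrier := cocycles SL_poly sl Ad_eval0 (Suc 0)\<rparr>"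
abbreviation (input) "cocycle_mod0 \<equiv>
  (cochains (SL F n) sl (Suc 0))\<lparr>carrier := cocycles (SL F n) sl (Ad n) (Suc 0)\<rparr>"
abbreviation (input) "coboundaries0 \<equiv> coboundaries (SL F n) sl (Ad n) (Suc 0)"

lemma restrict_const_linear:
  "restrict_const (f \<oplus>\<^bsub>cocycle_mod\<^esub> k) = restrict_const f \<oplus>\<^bsub>cocycle_mod0\<^esub> restrict_const k"
  "restrict_const (a \<odot>\<^bsub>cocycle_mod\<^esub> f) = a \<odot>\<^bsub>cocycle_mod0\<^esub> restrict_const f"
  "restrict_const \<zero>\<^bsub>cocycle_mod\<^esub> = \<zero>\<^bsub>cocycle_mod0\<^esub>"
  using const_mat_SL
  by (auto simp: restrict_const_def cochains_simps tuples_1 simp del: SL_simps intro!: restrict_ext)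

text \<open>The chosen representative depends on the coset and not on the cochain, so linearity is
  pointwise. Only its membership in SL_n(F[t]) has to be known, to evaluate the operations on
  cochains there.\<close>

lemma restrict_upper_linear:
  "restrict_upper (f \<oplus>\<^bsub>cocycle_mod\<^esub> k) = restrict_upper f \<oplus>\<^bsub>homs\<^esub> restrict_upper k"
  "restrict_upper (a \<odot>\<^bsub>cocycle_mod\<^esub> f) = a \<odot>\<^bsub>homs\<^esub> restrict_upper f"
  "restrict_upper \<zero>\<^bsub>cocycle_mod\<^esub> = (\<lambda>X\<in>carrier (abelianization upper). \<zero>\<^bsub>sl\<^esub>)"
proof -
  have "(SOME A. A \<in> X) \<in> carrier SL_poly" if X: "X \<in> carrier (abelianization upper)" for X
  proof -
    obtain A where A: "A \<in> carrier upper" "X = coset A"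
      using X unfolding carrier_abelianization by blast
    show ?thesis
      unfolding A(2) by (rule upper_SL[OF upper.abelianization_coset_carrier[OF A(1) some_coset[OF A(1)]]])
  qed
  then show
    "restrict_upper (f \<oplus>\<^bsub>cocycle_mod\<^esub> k) = restrict_upper f \<oplus>\<^bsub>homs\<^esub> restrict_upper k"
    "restrict_upper (a \<odot>\<^bsub>cocycle_mod\<^esub> f) = a \<odot>\<^bsub>homs\<^esub> restrict_upper f"
    "restrict_upper \<zero>\<^bsub>cocycle_mod\<^esub> = (\<lambda>X\<in>carrier (abelianization upper). \<zero>\<^bsub>sl\<^esub>)"
    by (auto simp: restrict_upper_def cochains_simps tuples_1 equivariant_homs_simps
        simp del: SL_simps sl_module_simps intro!: restrict_ext)
qed

text \<open>Defined on cocycles and not on classes, in the form that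
  \<open>quotient_module_iso\<close> expects; the coboundaries enter as its kernel.\<close>

definition splitting :: "('a poly mat list \<Rightarrow> 'a mat) \<Rightarrow> _" where
  "splitting f = (coboundaries0 +>\<^bsub>cocycle_mod0\<^esub> restrict_const f, restrict_upper f)"

lemma splitting_hom:
  "splitting \<in> LinearCombinations.module_hom class_ring cocycle_mod
     (direct_sum (quotient_module cocycle_mod0 coboundaries0) homs)"
proof -
  note M = SL_rep.cocycle_module SL_rep.coboundaries_1_submodule
  have c: "restrict_const f \<in> carrier cocycle_mod0" if "f \<in> carrier cocycle_mod" for f
    using restrict_const_cocycle that by simp
  show ?thesis
    unfolding LinearCombinations.module_hom_def direct_sum_simps
  proof (intro CollectI conjI funcsetI allI impI; (elim conjE)?)
    fix f assume f: "f \<in> carrier cocycle_mod"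
    show "splitting f \<in> carrier (quotient_module cocycle_mod0 coboundaries0) \<times> carrier homs"
      unfolding splitting_def carrier_quotient_module[OF M]
      using c[OF f] restrict_upper_hom f by auto
    show "splitting (a \<odot>\<^bsub>cocycle_mod\<^esub> f) =
      (a \<odot>\<^bsub>quotient_module cocycle_mod0 coboundaries0\<^esub> fst (splitting f), a \<odot>\<^bsub>homs\<^esub> snd (splitting f))" for a
      unfolding splitting_def restrict_const_linear restrict_upper_linear fst_conv snd_conv
      using quotient_module_smult[OF M _ c[OF f], of a] by simp
    fix k assume k: "k \<in> carrier cocycle_mod"
    show "splitting (f \<oplus>\<^bsub>cocycle_mod\<^esub> k) =
      (fst (splitting f) \<oplus>\<^bsub>quotient_module cocycle_mod0 coboundaries0\<^esub> fst (splitting k),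
       snd (splitting f) \<oplus>\<^bsub>homs\<^esub> snd (splitting k))"
      unfolding splitting_def restrict_const_linear restrict_upper_linear fst_conv snd_conv
      using quotient_module_add[OF M c[OF f] c[OF k]] by simp
  qed
qed

lemma log_deriv_cocycle:
  "(\<lambda>gs\<in>tuples SL_poly (Suc 0). log_deriv n (hd gs)) \<in> cocycles SL_poly sl Ad_eval0 (Suc 0)"
  (is "?\<delta> \<in> _")
  unfolding P_rep.cocycles_1 carrier_cochains_1
proof (intro conjI ballI)
  have \<delta>: "?\<delta> [A] = log_deriv n A" if "A \<in> carrier SL_poly" for A
    using that by (simp add: tuples_1 del: SL_simps)
  fix A assume A: "A \<in> carrier SL_poly"
  show "?\<delta> [A] \<in> carrier sl" unfolding \<delta>[OF A] by (rule log_deriv_sl[OF A])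
  fix B assume B: "B \<in> carrier SL_poly"
  show "?\<delta> [A \<otimes>\<^bsub>SL_poly\<^esub> B] = ?\<delta> [A] \<oplus>\<^bsub>sl\<^esub> Ad_eval0 A (?\<delta> [B])"
    unfolding \<delta>[OF A] \<delta>[OF B] \<delta>[OF P_rep.G.m_closed[OF A B]]
    using log_deriv_mult[OF A B] by simp
qed simp

lemma inflation_cocycle:
  assumes f: "f \<in> cocycles (SL F n) sl (Ad n) (Suc 0)"
  shows "(\<lambda>gs\<in>tuples SL_poly (Suc 0). f [eval0 (hd gs)]) \<in> cocycles SL_poly sl Ad_eval0 (Suc 0)"
  (is "?f \<in> _")
  unfolding P_rep.cocycles_1 carrier_cochains_1
proof (intro conjI ballI)
  have val: "?f [A] = f [eval0 A]" if "A \<in> carrier SL_poly" for A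
    using that by (simp add: tuples_1 del: SL_simps)
  have e: "eval0 A \<in> carrier (SL F n)" if "A \<in> carrier SL_poly" for A
    using eval0_hom that by (rule hom_in_carrier)
  fix A assume A: "A \<in> carrier SL_poly"
  show "?f [A] \<in> carrier sl" unfolding val[OF A] by (rule SL_rep.cocycle_closed[OF f e[OF A]])
  fix B assume B: "B \<in> carrier SL_poly"
  have "eval0 (A \<otimes>\<^bsub>SL_poly\<^esub> B) = eval0 A \<otimes>\<^bsub>SL F n\<^esub> eval0 B"
    using A B eval0_mult[of A n B] by simp
  then show "?f [A \<otimes>\<^bsub>SL_poly\<^esub> B] = ?f [A] \<oplus>\<^bsub>sl\<^esub> Ad_eval0 A (?f [B])"
    unfolding val[OF A] val[OF B] val[OF P_rep.G.m_closed[OF A B]]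
    using SL_rep.cocycle_mult[OF f e[OF A] e[OF B]] by (simp only:)
qed simp

text \<open>A preimage of the class of \<open>f0\<close> and of \<open>\<phi>\<close> is the
  inflation of \<open>f0\<close> plus \<open>c\<close> times the logarithmic derivative. The second
  summand vanishes on constants, and the first vanishes on C because a cocycle is zero at the
  identity, so the two components do not interfere.\<close>

lemma splitting_surj:
  "splitting ` carrier cocycle_mod =
     carrier (direct_sum (quotient_module cocycle_mod0 coboundaries0) homs)"
proof
  show "splitting ` carrier cocycle_mod \<subseteq>
      carrier (direct_sum (quotient_module cocycle_mod0 coboundaries0) homs)"
    using LinearCombinations.module_hom_closed[OF splitting_hom] by blast
  show "carrier (direct_sum (quotient_module cocycle_mod0 coboundaries0) homs) \<subseteq>
      splitting ` carrier cocycle_mod"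
  proof
    fix z assume "z \<in> carrier (direct_sum (quotient_module cocycle_mod0 coboundaries0) homs)"
    then obtain f0 \<phi> where f0: "f0 \<in> cocycles (SL F n) sl (Ad n) (Suc 0)" and \<phi>: "\<phi> \<in> carrier homs"
      and z: "z = (coboundaries0 +>\<^bsub>cocycle_mod0\<^esub> f0, \<phi>)"
      unfolding direct_sum_simps
        carrier_quotient_module[OF SL_rep.cocycle_module SL_rep.coboundaries_1_submodule]
      by auto
    obtain c where c: "\<And>A. A \<in> carrier upper \<Longrightarrow> \<phi> (coset A) = c \<cdot>\<^sub>m deriv0 A"
      using equivariant_hom_eq_deriv0[OF n \<phi>] by blast
    define f1 f2 where "f1 = (\<lambda>gs\<in>tuples SL_poly (Suc 0). f0 [eval0 (hd gs)])"
      and "f2 = (\<lambda>gs\<in>tuples SL_poly (Suc 0). log_deriv n (hd gs))"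
    interpret Z: Module.module class_ring cocycle_mod by (rule P_rep.cocycle_module)
    define f where "f = f1 \<oplus>\<^bsub>cocycle_mod\<^esub> c \<odot>\<^bsub>cocycle_mod\<^esub> f2"
    have f12: "f1 \<in> carrier cocycle_mod" "f2 \<in> carrier cocycle_mod"
      using inflation_cocycle[OF f0] log_deriv_cocycle by (simp_all add: f1_def f2_def)
    have "f \<in> carrier cocycle_mod"
      unfolding f_def using f12 by (intro Z.M.a_closed Z.smult_closed) auto
    then have f: "f \<in> cocycles SL_poly sl Ad_eval0 (Suc 0)" by simp
    have val: "f [A] = f0 [eval0 A] + c \<cdot>\<^sub>m log_deriv n A" if "A \<in> carrier SL_poly" for A
      using that by (simp add: f_def f1_def f2_def cochains_simps tuples_1 del: SL_simps)
    have "restrict_const f = f0"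
    proof (rule cochain_1_eqI)
      show "restrict_const f \<in> extensional (tuples (SL F n) (Suc 0))" by (simp add: restrict_const_def)
      show "f0 \<in> extensional (tuples (SL F n) (Suc 0))"
        using f0 unfolding SL_rep.cocycles_1 carrier_cochains_1 by blast
      fix g assume g: "g \<in> carrier (SL F n)"
      have "g \<in> carrier (SL TYPE('a) n)" using g by simp
      from log_deriv_const_mat[OF this] show "restrict_const f [g] = f0 [g]"
        unfolding restrict_const_eq[OF g] val[OF const_mat_SL[OF g]] eval0_const_mat
        using SL_rep.cocycle_closed[OF f0 g] by simp
    qed
    moreover have "restrict_upper f = \<phi>"
    proof (rule extensionalityI[of _ "carrier (abelianization upper)"])
      show "restrict_upper f \<in> extensional (carrier (abelianization upper))" by (simp add: restrict_upper_def)
      show "\<phi> \<in> extensional (carrier (abelianization upper))"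
        using \<phi> by (auto simp: equivariant_homs_def PiE_iff)
      fix X assume "X \<in> carrier (abelianization upper)"
      then obtain A where A: "A \<in> carrier upper" "X = coset A" unfolding carrier_abelianization by blast
      have "f [A] = c \<cdot>\<^sub>m deriv0 A"
        unfolding val[OF upper_SL[OF A(1)]] eval0_upper_congruence[OF A(1)] log_deriv_upper_congruence[OF A(1)]
        using SL_rep.cocycle_one[OF f0] upper_SL[OF A(1)] by simp
      then show "restrict_upper f X = \<phi> X"
        unfolding A(2) restrict_upper_coset[OF f A(1)] c[OF A(1)] .
    qed
    ultimately have "splitting f = z" by (simp add: splitting_def z)
    then show "z \<in> splitting ` carrier cocycle_mod" using f by force
  qed
qed

lemma splitting_kernel:
  assumes f: "f \<in> carrier cocycle_mod"
  shows "splitting f = splitting \<zero>\<^bsub>cocycle_mod\<^esub> \<longleftrightarrow> f \<in> coboundaries SL_poly sl Ad_eval0 (Suc 0)"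
proof -
  have f': "f \<in> cocycles SL_poly sl Ad_eval0 (Suc 0)" using f by simp
  interpret Z0: Module.module class_ring cocycle_mod0 by (rule SL_rep.cocycle_module)
  have sub: "additive_subgroup coboundaries0 cocycle_mod0"
    by (rule submodule_additive_subgroup[OF SL_rep.cocycle_module SL_rep.coboundaries_1_submodule])
  interpret B0: abelian_subgroup coboundaries0 cocycle_mod0
    by (rule abelian_subgroupI3[OF sub]) unfold_locales
  have rf: "restrict_const f \<in> carrier cocycle_mod0" using restrict_const_cocycle[OF f'] by simp
  \<comment> \<open>The zero class is the subgroup of coboundaries itself, so equality of first
    components means membership in it.\<close>
  have "splitting \<zero>\<^bsub>cocycle_mod\<^esub> = (coboundaries0, \<lambda>X\<in>carrier (abelianization upper). \<zero>\<^bsub>sl\<^esub>)"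
    unfolding splitting_def restrict_const_linear restrict_upper_linear
    using B0.a_rcos_const[OF B0.zero_closed] by simp
  then have "splitting f = splitting \<zero>\<^bsub>cocycle_mod\<^esub> \<longleftrightarrow>
    coboundaries0 +>\<^bsub>cocycle_mod0\<^esub> restrict_const f = coboundaries0 \<and>
    restrict_upper f = (\<lambda>X\<in>carrier (abelianization upper). \<zero>\<^bsub>sl\<^esub>)"
    by (simp add: splitting_def)
  also have "coboundaries0 +>\<^bsub>cocycle_mod0\<^esub> restrict_const f = coboundaries0 \<longleftrightarrow>
    restrict_const f \<in> coboundaries0"
    using B0.a_rcos_self[OF rf] B0.a_rcos_const by blast
  also have "restrict_upper f = (\<lambda>X\<in>carrier (abelianization upper). \<zero>\<^bsub>sl\<^esub>) \<longleftrightarrow>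
    (\<forall>A\<in>carrier upper. f [A] = \<zero>\<^bsub>sl\<^esub>)"
  proof
    assume eq: "restrict_upper f = (\<lambda>X\<in>carrier (abelianization upper). \<zero>\<^bsub>sl\<^esub>)"
    show "\<forall>A\<in>carrier upper. f [A] = \<zero>\<^bsub>sl\<^esub>"
    proof
      fix A assume A: "A \<in> carrier upper"
      have "f [A] = (\<lambda>X\<in>carrier (abelianization upper). \<zero>\<^bsub>sl\<^esub>) (coset A)"
        unfolding restrict_upper_coset[OF f' A, symmetric] eq ..
      then show "f [A] = \<zero>\<^bsub>sl\<^esub>" using coset_carrier[OF A] by simp
    qed
  next
    assume zero: "\<forall>A\<in>carrier upper. f [A] = \<zero>\<^bsub>sl\<^esub>"
    show "restrict_upper f = (\<lambda>X\<in>carrier (abelianization upper). \<zero>\<^bsub>sl\<^esub>)"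
    proof (rule extensionalityI[of _ "carrier (abelianization upper)"])
      fix X assume X: "X \<in> carrier (abelianization upper)"
      then obtain A where A: "A \<in> carrier upper" "X = coset A" unfolding carrier_abelianization by blast
      have "restrict_upper f X = \<zero>\<^bsub>sl\<^esub>"
        unfolding A(2) restrict_upper_coset[OF f' A(1)] using zero A(1) by blast
      then show "restrict_upper f X = (\<lambda>X\<in>carrier (abelianization upper). \<zero>\<^bsub>sl\<^esub>) X" using X by simp
    qed (simp_all add: restrict_upper_def)
  qed
  also have "restrict_const f \<in> coboundaries0 \<and> (\<forall>A\<in>carrier upper. f [A] = \<zero>\<^bsub>sl\<^esub>) \<longleftrightarrow>
    f \<in> coboundaries SL_poly sl Ad_eval0 (Suc 0)"
  proof
    assume *: "restrict_const f \<in> coboundaries0 \<and> (\<forall>A\<in>carrier upper. f [A] = \<zero>\<^bsub>sl\<^esub>)"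
    then obtain v where v: "v \<in> carrier sl"
      and fv: "\<forall>g\<in>carrier (SL F n). restrict_const f [g] = Ad n g v \<ominus>\<^bsub>sl\<^esub> v"
      unfolding SL_rep.coboundaries_1 by blast
    \<comment> \<open>The coboundary of the same vector \<open>v\<close>, now on the whole group. It
      agrees with \<open>f\<close> on the constants by the choice of \<open>v\<close>, and like
      \<open>f\<close> it vanishes on C, where \<open>eval0\<close> is the identity matrix.\<close>
    define k where "k = (\<lambda>gs\<in>tuples SL_poly (Suc 0). Ad_eval0 (hd gs) v \<ominus>\<^bsub>sl\<^esub> v)"
    have k: "k [A] = Ad_eval0 A v \<ominus>\<^bsub>sl\<^esub> v" if "A \<in> carrier SL_poly" for A
      using that by (simp add: k_def tuples_1 del: SL_simps)
    have kB: "k \<in> coboundaries SL_poly sl Ad_eval0 (Suc 0)"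
      unfolding P_rep.coboundaries_1 using v k by (auto simp: k_def simp del: SL_simps sl_module_simps)
    have kZ: "k \<in> cocycles SL_poly sl Ad_eval0 (Suc 0)"
      using kB P_rep.coboundaries_1_submodule by (auto simp: LinearCombinations.submodule_def)
    let ?H = "{A \<in> carrier SL_poly. f [A] = k [A]}"
    have "?H = carrier SL_poly"
    proof (rule generated_by_constants_and_upper[OF n P_rep.cocycle_equalizer_subgroup[OF f' kZ]])
      show "const_mat ` carrier (SL F n) \<subseteq> ?H"
      proof
        fix A assume "A \<in> const_mat ` carrier (SL F n)"
        then obtain g where g: "g \<in> carrier (SL F n)" "A = const_mat g" by blast
        have "f [A] = Ad n g v \<ominus>\<^bsub>sl\<^esub> v" 
          unfolding g(2) restrict_const_eq[OF g(1), symmetric] using fv g(1) by blast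
        moreover have "k [A] = Ad n g v \<ominus>\<^bsub>sl\<^esub> v"
          using k[OF const_mat_SL[OF g(1)]] by (simp only: g(2) eval0_const_mat)
        ultimately have "f [A] = k [A]" by (simp only:)
        then show "A \<in> ?H" using const_mat_SL[OF g(1)] unfolding g(2) by (intro CollectI conjI)
      qed
      show "carrier upper \<subseteq> ?H"
      proof
        fix A assume A: "A \<in> carrier upper"
        have "Ad_eval0 A v = v" using SL_rep.action_one[OF v] by (simp add: eval0_upper_congruence[OF A])
        then have "k [A] = v \<ominus>\<^bsub>sl\<^esub> v" using k[OF upper_SL[OF A]] by (simp only:)
        also have "\<dots> = \<zero>\<^bsub>sl\<^esub>" using SL_rep.M.minus_eq_zero_iff[OF v v] by blast
        finally have "f [A] = k [A]" using * A by (simp del: sl_module_simps)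
        then show "A \<in> ?H" using upper_SL[OF A] by (intro CollectI conjI)
      qed
    qed
    then have "f [A] = k [A]" if "A \<in> carrier SL_poly" for A using that by blast
    then have "f = k"
      using f' kZ unfolding P_rep.cocycles_1 carrier_cochains_1
      by (intro cochain_1_eqI[of f SL_poly k]) blast+
    then show "f \<in> coboundaries SL_poly sl Ad_eval0 (Suc 0)" using kB by simp
  next
    assume "f \<in> coboundaries SL_poly sl Ad_eval0 (Suc 0)"
    then obtain v where v: "v \<in> carrier sl" and fv: "\<forall>A\<in>carrier SL_poly. f [A] = Ad_eval0 A v \<ominus>\<^bsub>sl\<^esub> v"
      unfolding P_rep.coboundaries_1 by blast
    have "restrict_const f [g] = Ad n g v \<ominus>\<^bsub>sl\<^esub> v" if g: "g \<in> carrier (SL F n)" for g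
      unfolding restrict_const_eq[OF g] using bspec[OF fv const_mat_SL[OF g]]
      by (simp only: eval0_const_mat)
    then have "restrict_const f \<in> coboundaries0"
      unfolding SL_rep.coboundaries_1 using v by (auto simp: restrict_const_def simp del: SL_simps sl_module_simps)
    moreover have "f [A] = \<zero>\<^bsub>sl\<^esub>" if A: "A \<in> carrier upper" for A
    proof -
      have "Ad_eval0 A v = v" using SL_rep.action_one[OF v] by (simp add: eval0_upper_congruence[OF A])
      then have "f [A] = v \<ominus>\<^bsub>sl\<^esub> v" using bspec[OF fv upper_SL[OF A]] by (simp only:)
      also have "\<dots> = \<zero>\<^bsub>sl\<^esub>" using SL_rep.M.minus_eq_zero_iff[OF v v] by blast
      finally show ?thesis .
    qed
    ultimately show "restrict_const f \<in> coboundaries0 \<and> (\<forall>A\<in>carrier upper. f [A] = \<zero>\<^bsub>sl\<^esub>)" by blast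
  qed
  finally show ?thesis .
qed

lemma cohomology_splitting:
  "isomorphic_modules class_ring (group_cohomology 1 SL_poly sl Ad_eval0)
     (direct_sum (group_cohomology 1 (SL F n) sl (Ad n)) homs)"
  unfolding group_cohomology_def One_nat_def
  by (rule quotient_module_iso[OF P_rep.cocycle_module P_rep.coboundaries_1_submodule
        splitting_hom splitting_surj splitting_kernel])

end

theorem theorem5p2:
  fixes F :: "'a::field_char_0 itself" and n :: nat
  assumes "n \<ge> 3"
  defines "V \<equiv> sl_module F n"
  shows "isomorphic_modules class_ring
           (group_cohomology 1 (SL TYPE('a poly) n) V (\<lambda>A. Ad n (eval0 A)))
           (direct_sum
             (group_cohomology 1 (SL F n) V (Ad n))
             (equivariant_homs (Borel F n)
               (abelianization (upper_congruence_group F n)) (conj_coset n) V (Ad n)))"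
  unfolding V_def by (rule cohomology_splitting[OF assms(1)])

end
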